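(* Let $\mathfrak{g}=\mathfrak{sl}_2(\mathbb{C})$, let $z$ be any element of the center $\mathfrak{Z}(\mathfrak{U}\mathfrak{g})$ of the enveloping algebra $\mathfrak{U}\mathfrak{g}$, and let $H_z$ be the infinitesimal Hecke algebra of $\mathfrak{sl}_2$ with parameter $z$. Then the center of $H_z$ is a polynomial algebra over $\mathbb{C}$ in one variable, and the generating central element has filtration degree $2$.
   Context: Let $\mathfrak{g}=\mathfrak{sl}_2(\mathbb{C})$ with standard basis $e,f,h$ ($[h,e]=2e$, $[h,f]=-2f$, $[e,f]=h$), and let $V$ be its two-dimensional irreducible representation over $\mathbb{C}$ with basis $x,y$, where $e\cdot x=0$, $e\cdot y=x$, $f\cdot x=y$, $f\cdot y=0$, $h\cdot x=x$, $h\cdot y=-y$. Let $TV$ be the tensor algebra of $V$. For $z\in\mathfrak{Z}(\mathfrak{U}\mathfrak{g})$, $H_z$ is the quotient of the semidirect product $\mathfrak{U}\mathfrak{g}\ltimes TV$ (in which $[a,v]=a\cdot v$ for $a\in\mathfrak{g}$, $v\in V$) by the two-sided ideal generated by $xy-yx-z$. Thus $H_z$ is the associative unital $\mathbb{C}$-algebra generated by $e,f,h,x,y$ with the $\mathfrak{sl}_2$ relations, the relations $[e,x]=0$, $[e,y]=x$, $[f,x]=y$, $[f,y]=0$, $[h,x]=x$, $[h,y]=-y$, and $[x,y]=z$. The algebra $H_z$ is filtered by giving elements of $\mathfrak{U}\mathfrak{g}$ degree $0$ and $x,y$ degree $1$; "filtration degree" refers to this filtration. (It is known, as a PBW theorem,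 that the associated graded algebra is $\mathfrak{U}(\mathfrak{g}\ltimes V)=H_0$, where $V$ is an abelian ideal.) *)

theory Defs
  imports
    Complex_Main
    "HOL-Library.Poly_Mapping"
    "HOL-Algebra.QuotRing"
    "HOL-Algebra.UnivPoly"
    "HOL-Algebra.Algebraic_Closure_Type"
begin

text \<open>
  Words form a monoid under concatenation, so the convolution product of
  \<^theory>\<open>HOL-Library.Poly_Mapping\<close> makes the finitely supported complex-valued functions
  on words into the free associative unital complex algebra.
\<close>

instantiation list :: (type) monoid_add
begin

definition zero_list :: "'a list" where "0 = []"
definition plus_list :: "'a list \<Rightarrow> 'a list \<Rightarrow> 'a list" where "xs + ys = xs @ ys"

instance by standard (simp_all add: zero_list_def plus_list_def)

end

type_synonym 'a free_alg = "'a list \<Rightarrow>\<^sub>0 complex"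

definition gen :: "'a \<Rightarrow> 'a free_alg" where
  "gen a = Poly_Mapping.single [a] 1"

definition scalar :: "complex \<Rightarrow> 'a free_alg" where
  "scalar c = Poly_Mapping.single [] c"

text \<open>The algebra homomorphism of free algebras induced by a map of the generators.\<close>

definition map_free :: "('a \<Rightarrow> 'b) \<Rightarrow> 'a free_alg \<Rightarrow> 'b free_alg" where
  "map_free \<phi> p =
     (\<Sum>w\<in>Poly_Mapping.keys p. Poly_Mapping.single (map \<phi> w) (Poly_Mapping.lookup p w))"

definition commutator :: "'a :: ring \<Rightarrow> 'a \<Rightarrow> 'a" where
  "commutator a b = a * b - b * a"

abbreviation free_ring :: "'a free_alg ring" where
  "free_ring \<equiv> ring_of_type_algebra"

definition ring_center :: "('a, 'm) ring_scheme \<Rightarrow> 'a set" where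
  "ring_center R =
     {a \<in> carrier R. \<forall>b\<in>carrier R. a \<otimes>\<^bsub>R\<^esub> b = b \<otimes>\<^bsub>R\<^esub> a}"

datatype sl2_basis = Sl2_e | Sl2_f | Sl2_h

definition sl2_relations :: "sl2_basis free_alg set" where
  "sl2_relations =
     (let e = gen Sl2_e; f = gen Sl2_f; h = gen Sl2_h in
      {commutator h e - 2 * e,
       commutator h f + 2 * f,
       commutator e f - h})"

definition U_sl2 :: "sl2_basis free_alg set ring" where
  "U_sl2 = free_ring Quot (genideal free_ring sl2_relations)"

datatype V_basis = V_x | V_y

type_synonym hecke_gen = "sl2_basis + V_basis"

text \<open>
  The parameter \<open>z\<close> is an element of \<^const>\<open>U_sl2\<close>, i.e. a coset in the free algebra on
  \<open>e, f, h\<close>.  The relation \<open>[x, y] = z\<close> is imposed for every representative of this coset; any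
  two of them differ by an element of the ideal generated by the relations of \<open>sl\<^sub>2\<close>, so this
  generates the same ideal as a single representative does.
\<close>

definition hecke_relations :: "sl2_basis free_alg set \<Rightarrow> hecke_gen free_alg set" where
  "hecke_relations z =
     (let e = gen (Inl Sl2_e); f = gen (Inl Sl2_f); h = gen (Inl Sl2_h);
          x = gen (Inr V_x); y = gen (Inr V_y) in
      map_free Inl ` sl2_relations \<union>
      {commutator e x,
       commutator e y - x,
       commutator f x - y,
       commutator f y,
       commutator h x - x,
       commutator h y + y} \<union>
      {commutator x y - map_free Inl w | w. w \<in> z})"

definition hecke_ideal :: "sl2_basis free_alg set \<Rightarrow> hecke_gen free_alg set" where
  "hecke_ideal z = genideal free_ring (hecke_relations z)"

definition hecke :: "sl2_basis free_alg set \<Rightarrow> hecke_gen free_alg set ring" where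
  "hecke z = free_ring Quot (hecke_ideal z)"

definition hecke_class ::
    "sl2_basis free_alg set \<Rightarrow> hecke_gen free_alg \<Rightarrow> hecke_gen free_alg set" where
  "hecke_class z p = hecke_ideal z +>\<^bsub>free_ring\<^esub> p"

definition hecke_scalar :: "sl2_basis free_alg set \<Rightarrow> complex \<Rightarrow> hecke_gen free_alg set" where
  "hecke_scalar z c = hecke_class z (scalar c)"

definition hecke_center :: "sl2_basis free_alg set \<Rightarrow> hecke_gen free_alg set ring" where
  "hecke_center z = (hecke z)\<lparr>carrier := ring_center (hecke z)\<rparr>"

text \<open>
  \<open>hecke_filtration z n\<close> is the span of the products of generators in which at most \<open>n\<close> factors
  are \<open>x\<close> or \<open>y\<close>.
\<close>

definition V_length :: "hecke_gen list \<Rightarrow> nat" where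
  "V_length w = length (filter (\<lambda>a. a \<in> range Inr) w)"

definition hecke_filtration ::
    "sl2_basis free_alg set \<Rightarrow> nat \<Rightarrow> hecke_gen free_alg set set" where
  "hecke_filtration z n =
     hecke_class z ` {p. \<forall>w\<in>Poly_Mapping.keys p. V_length w \<le> n}"

definition filtration_degree ::
    "sl2_basis free_alg set \<Rightarrow> hecke_gen free_alg set \<Rightarrow> nat" where
  "filtration_degree z a = (LEAST n. a \<in> hecke_filtration z n)"

text \<open>
  The algebra with underlying ring \<open>A\<close> and structure map \<open>\<iota> : \<complex> \<rightarrow> A\<close> is the polynomial
  algebra in the single variable \<open>t\<close>: evaluation at \<open>t\<close> is an isomorphism from \<open>\<complex>[T]\<close>.  It
  restricts to \<open>\<iota>\<close> on constants, so it is an isomorphism of complex algebras.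
\<close>

definition polynomial_algebra_on ::
    "('a, 'm) ring_scheme \<Rightarrow> (complex \<Rightarrow> 'a) \<Rightarrow> 'a \<Rightarrow> bool" where
  "polynomial_algebra_on A \<iota> t \<longleftrightarrow>
     t \<in> carrier A \<and>
     eval ring_of_type_algebra A \<iota> t \<in> ring_iso (UP ring_of_type_algebra) A"

end

theory Submission
  imports Defs
begin


section \<open>The free algebra\<close>

text \<open>Everything is read off from a family of representations. For each complex t the algebra
  H_z acts on formal combinations of vectors v(a, b), with a and b integers: h acts by a + b, the
  shifted Casimir element (h+1)^2 + 4fe acts by l^2 with l = a - b + 1/2, and x and y move l by 1 up
  or down. A central z of U(sl2) acts by P(l^2) for some polynomial P
  (\<open>rep_U_sl2_center\<close>). The relation [x, y] = z then becomes the difference equation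
  G((l+1/2)^2) - G((l-1/2)^2) = l P(l^2), which has a polynomial solution G
  (\<open>ex_central_antidifference\<close>). Adding a constant t to G does not affect the equation,
  and this constant indexes the family.

  The generator of the center is T = f x^2 - e y^2 - h x y + u, where u in U(sl2) is chosen so that
  T acts by the scalar t (\<open>rep_T\<close>). Rewriting shows that the monomials T^k e^a h^b f^c
  x^i y^j with c = 0 or i <= 1 span H_z compatibly with the filtration, T having degree 2
  (\<open>word_value_normal_span\<close>); this is a PBW basis in which f x^2 is traded for T.
  Comparing the components that raise l the most, for varying t, a and b, shows that these monomials
  act independently (\<open>monomials_independent\<close>). Hence the family is jointly faithful
  (\<open>rep_delta_faithful\<close>). In particular T is central, and distinct polynomials in T are
  distinct elements.

  Conversely, let p be central. Since p commutes with the Casimir element, a leading part of p that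
  raises l by d > 0 would need (l+d)^2 = l^2 for infinitely many l. So d = 0, and p is a combination
  of products T^k u_k with u_k in U(sl2) (\<open>central_imp_degree_0\<close>). Commuting with h, e
  and x forces p to act by a scalar that is polynomial in t, so p = g(T) for a polynomial g
  (\<open>central_imp_alg_eval_T\<close>). Finally T has degree exactly 2 because it is itself a
  basis monomial of degree 2 (\<open>filtration_degree_T\<close>).\<close>

lemma mult_single_list:
  "Poly_Mapping.single u c * Poly_Mapping.single v d
    = (Poly_Mapping.single (u @ v) (c * d) :: 'a free_alg)"
  by (simp add: mult_single plus_list_def)

lemma one_free_alg: "(1 :: 'a free_alg) = Poly_Mapping.single [] 1"
  by (simp add: single_one[symmetric] zero_list_def del: single_one)

lemma scalar_0 [simp]: "scalar 0 = (0 :: 'a free_alg)"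
  and scalar_1 [simp]: "scalar 1 = (1 :: 'a free_alg)"
  and scalar_add: "scalar (c + d) = (scalar c + scalar d :: 'a free_alg)"
  and scalar_mult: "scalar (c * d) = (scalar c * scalar d :: 'a free_alg)"
  and scalar_uminus: "scalar (- c) = (- scalar c :: 'a free_alg)"
  by (simp_all add: scalar_def one_free_alg single_add mult_single_list single_uminus)

lemma scalar_numeral: "scalar (numeral n) = (numeral n :: 'a free_alg)"
  unfolding scalar_def zero_list_def[symmetric] by simp

lemma free_alg_sum_monomials:
  "p = (\<Sum>w\<in>Poly_Mapping.keys p. Poly_Mapping.single w (Poly_Mapping.lookup p w))"
  by (rule poly_mapping_eqI)
     (simp add: lookup_sum lookup_single when_def in_keys_iff)

lemma free_alg_induct [case_names zero add single]:
  fixes p :: "'a free_alg"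
  assumes "P 0" "\<And>p q. P p \<Longrightarrow> P q \<Longrightarrow> P (p + q)"
    and "\<And>w c. P (Poly_Mapping.single w c)"
  shows "P p"
proof -
  have "P (\<Sum>w\<in>A. Poly_Mapping.single w (Poly_Mapping.lookup p w))" if "finite A" for A
    using that by (induction A) (auto intro: assms)
  then show ?thesis
    by (subst free_alg_sum_monomials) simp
qed

lemma scalar_commute: "scalar c * p = p * (scalar c :: 'a free_alg)"
  by (induction p rule: free_alg_induct)
     (simp_all add: distrib_left distrib_right scalar_def mult_single_list mult.commute)

lemma scalar_left_commute: "p * (scalar c * q) = scalar c * (p * (q :: 'a free_alg))"
  by (metis scalar_commute mult.assoc)

interpretation free_alg: vector_space "\<lambda>c (p :: 'a free_alg). scalar c * p"
  by standard (simp_all add: distrib_left distrib_right scalar_add scalar_mult mult.assoc)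

lemma map_free_eq_sum:
  assumes "finite A" "Poly_Mapping.keys p \<subseteq> A"
  shows "map_free \<phi> p = (\<Sum>w\<in>A. Poly_Mapping.single (map \<phi> w) (Poly_Mapping.lookup p w))"
  unfolding map_free_def using assms
  by (intro sum.mono_neutral_left) (auto simp: in_keys_iff)

lemma map_free_0 [simp]: "map_free \<phi> 0 = 0"
  by (simp add: map_free_def)

lemma map_free_single [simp]:
  "map_free \<phi> (Poly_Mapping.single w c) = Poly_Mapping.single (map \<phi> w) c"
  by (simp add: map_free_eq_sum[of "{w}"])

lemma map_free_add: "map_free \<phi> (p + q) = map_free \<phi> p + map_free \<phi> q"
proof -
  let ?A = "Poly_Mapping.keys p \<union> Poly_Mapping.keys q"
  have "finite ?A" "Poly_Mapping.keys (p + q) \<subseteq> ?A"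
    using keys_add[of p q] by auto
  then show ?thesis
    by (simp add: map_free_eq_sum[of ?A] lookup_add single_add sum.distrib)
qed

lemma map_free_mult: "map_free \<phi> (p * q) = map_free \<phi> p * map_free \<phi> q"
proof (induction p rule: free_alg_induct)
  case (single u c)
  show ?case
    by (induction q rule: free_alg_induct)
       (simp_all add: distrib_left map_free_add mult_single_list)
qed (simp_all add: distrib_right map_free_add)

lemma map_free_uminus: "map_free \<phi> (- p) = - map_free \<phi> p"
  using map_free_add[of \<phi> p "- p"] by (simp add: eq_neg_iff_add_eq_0 add.commute)

lemma map_free_diff: "map_free \<phi> (p - q) = map_free \<phi> p - map_free \<phi> q"
  by (simp add: map_free_add map_free_uminus diff_conv_add_uminus del: add_uminus_conv_diff)

lemma map_free_scalar [simp]: "map_free \<phi> (scalar c) = scalar c"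
  and map_free_gen [simp]: "map_free \<phi> (gen a) = gen (\<phi> a)"
  by (simp_all add: scalar_def gen_def)

lemma map_free_numeral [simp]: "map_free \<phi> (numeral n) = numeral n"
  by (metis map_free_scalar scalar_numeral)

section \<open>Ideals of the free algebra\<close>

lemma free_ring_simps [simp]:
  "carrier free_ring = UNIV"
  "x \<oplus>\<^bsub>free_ring\<^esub> y = x + y" "x \<otimes>\<^bsub>free_ring\<^esub> y = x * y"
  "\<one>\<^bsub>free_ring\<^esub> = 1" "\<zero>\<^bsub>free_ring\<^esub> = 0"
  by (simp_all add: ring_of_type_algebra_def)

lemma ring_free_ring: "ring (free_ring :: 'a free_alg ring)"
  unfolding ring_of_type_algebra_def
  by unfold_locales
     (auto simp: Units_def mult.assoc distrib_left distrib_right add.assoc add.commute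
        intro: exI[of _ "- _"])

lemma free_ring_a_inv [simp]: "\<ominus>\<^bsub>free_ring\<^esub> p = - (p :: 'a free_alg)"
proof -
  interpret ring "free_ring :: 'a free_alg ring" by (rule ring_free_ring)
  show ?thesis using minus_equality[of "- p" p] by simp
qed

locale free_ideal =
  fixes I :: "'a free_alg set"
  assumes zero_mem: "0 \<in> I"
    and add_mem: "p \<in> I \<Longrightarrow> q \<in> I \<Longrightarrow> p + q \<in> I"
    and mult_left_mem: "p \<in> I \<Longrightarrow> q * p \<in> I"
    and mult_right_mem: "p \<in> I \<Longrightarrow> p * q \<in> I"
begin

lemma uminus_mem: "p \<in> I \<Longrightarrow> - p \<in> I"
  using mult_left_mem[of p "-1"] by simp

lemma diff_mem: "p \<in> I \<Longrightarrow> q \<in> I \<Longrightarrow> p - q \<in> I"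
  using add_mem[OF _ uminus_mem] by fastforce

lemma ideal: "ideal I free_ring"
proof (rule idealI)
  interpret ring "free_ring :: 'a free_alg ring" by (rule ring_free_ring)
  show "subgroup I (add_monoid free_ring)"
    by (rule add.subgroupI) (use zero_mem add_mem uminus_mem in \<open>auto simp: a_inv_def[symmetric]\<close>)
qed (use mult_left_mem mult_right_mem ring_free_ring in auto)

end

lemma free_ideal_iff: "ideal I (free_ring :: 'a free_alg ring) \<longleftrightarrow> free_ideal I"
proof
  assume "ideal I (free_ring :: 'a free_alg ring)"
  then interpret ideal I "free_ring :: 'a free_alg ring" .
  show "free_ideal I"
    using additive_subgroup.a_closed[OF additive_subgroup_axioms] I_l_closed I_r_closed additive_subgroup.zero_closed[OF additive_subgroup_axioms]
    by unfold_locales auto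
qed (rule free_ideal.ideal)

lemma free_ideal_genideal: "free_ideal (genideal free_ring S)"
  unfolding free_ideal_iff[symmetric]
  by (rule ring.genideal_ideal[OF ring_free_ring]) simp

lemma genideal_superset: "S \<subseteq> genideal (free_ring :: 'a free_alg ring) S"
  by (rule ring.genideal_self[OF ring_free_ring]) simp

lemma genideal_least:
  assumes "free_ideal I" "S \<subseteq> I"
  shows "genideal free_ring S \<subseteq> I"
  using assms by (intro ring.genideal_minimal[OF ring_free_ring]) (simp_all add: free_ideal_iff)

lemma coset_free_ring: "I +>\<^bsub>free_ring\<^esub> p = {i + p | i. i \<in> I}"
  by (auto simp: a_r_coset_def r_coset_def)

lemma (in free_ideal) coset_eq_iff: "I +>\<^bsub>free_ring\<^esub> p = I +>\<^bsub>free_ring\<^esub> q \<longleftrightarrow> p - q \<in> I"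
proof
  assume "I +>\<^bsub>free_ring\<^esub> p = I +>\<^bsub>free_ring\<^esub> q"
  then have "0 + p \<in> {i + q | i. i \<in> I}"
    unfolding coset_free_ring[symmetric] using zero_mem by (auto simp: coset_free_ring)
  then show "p - q \<in> I" by auto
next
  assume pq: "p - q \<in> I"
  have "i + p \<in> {i + q | i. i \<in> I}" if "i \<in> I" for i
    using add_mem[OF that pq] by (intro CollectI exI[of _ "i + (p - q)"]) simp
  moreover have "i + q \<in> {i + p | i. i \<in> I}" if "i \<in> I" for i
    using diff_mem[OF that pq] by (intro CollectI exI[of _ "i - (p - q)"]) simp
  ultimately show "I +>\<^bsub>free_ring\<^esub> p = I +>\<^bsub>free_ring\<^esub> q"
    unfolding coset_free_ring by blast
qed

lemma (in free_ideal) coset_mult: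
  "(I +>\<^bsub>free_ring\<^esub> p) \<otimes>\<^bsub>free_ring Quot I\<^esub> (I +>\<^bsub>free_ring\<^esub> q) = I +>\<^bsub>free_ring\<^esub> (p * q)"
  using ideal.rcoset_mult_add[OF ideal] by (simp add: FactRing_def)

lemma (in free_ideal) coset_add:
  "(I +>\<^bsub>free_ring\<^esub> p) \<oplus>\<^bsub>free_ring Quot I\<^esub> (I +>\<^bsub>free_ring\<^esub> q) = I +>\<^bsub>free_ring\<^esub> (p + q)"
  using ideal.a_rcos_sum[OF ideal] by (simp add: FactRing_def)

lemma carrier_free_Quot: "carrier (free_ring Quot I) = range (\<lambda>p. I +>\<^bsub>free_ring\<^esub> p)"
  by (auto simp: FactRing_def A_RCOSETS_def RCOSETS_def a_r_coset_def)

lemma (in free_ideal) coset_in_ring_center_iff: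
  "I +>\<^bsub>free_ring\<^esub> p \<in> ring_center (free_ring Quot I) \<longleftrightarrow> (\<forall>q. p * q - q * p \<in> I)"
  by (auto simp: ring_center_def carrier_free_Quot coset_mult coset_eq_iff)


section \<open>Two polynomial identities\<close>

text \<open>Even and odd parts in l: replacing l by -l exchanges the two half shifts, and (l +-
  1/2)^2 = l^2 + 1/4 +- l drives the induction. The point is that the sum of the two values is a
  polynomial in l^2, which enters the U(sl2) part of T.\<close>

lemma poly_half_shift_decomp:
  fixes G :: "complex poly"
  shows "\<exists>A B. \<forall>l. poly G ((l - 1/2)\<^sup>2) = poly A (l\<^sup>2) - l * poly B (l\<^sup>2)
             \<and> poly G ((l + 1/2)\<^sup>2) = poly A (l\<^sup>2) + l * poly B (l\<^sup>2)"
proof (induction G)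
  case 0
  show ?case by (intro exI[of _ 0]) simp
next
  case (pCons c G)
  from pCons.IH obtain A B where "\<forall>l. poly G ((l - 1/2)\<^sup>2) = poly A (l\<^sup>2) - l * poly B (l\<^sup>2)
    \<and> poly G ((l + 1/2)\<^sup>2) = poly A (l\<^sup>2) + l * poly B (l\<^sup>2)"
    by (elim exE)
  then have AB: "poly G ((l - 1/2)\<^sup>2) = poly A (l\<^sup>2) - l * poly B (l\<^sup>2)"
    "poly G ((l + 1/2)\<^sup>2) = poly A (l\<^sup>2) + l * poly B (l\<^sup>2)" for l
    by (simp_all only:)
  let ?A = "[:c:] + [:1/4, 1:] * A + [:0, 1:] * B" and ?B = "A + [:1/4, 1:] * B"
  show ?case
  proof (rule exI[of _ ?A], rule exI[of _ ?B], intro allI conjI)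
    fix l :: complex
    have sq: "(l - 1/2)\<^sup>2 = l\<^sup>2 + 1/4 - l" "(l + 1/2)\<^sup>2 = l\<^sup>2 + 1/4 + l"
      by (simp_all add: power2_diff power2_sum power_divide)
    show "poly (pCons c G) ((l - 1/2)\<^sup>2) = poly ?A (l\<^sup>2) - l * poly ?B (l\<^sup>2)"
      unfolding poly_pCons AB unfolding sq by (simp add: algebra_simps power2_eq_square)
    show "poly (pCons c G) ((l + 1/2)\<^sup>2) = poly ?A (l\<^sup>2) + l * poly ?B (l\<^sup>2)"
      unfolding poly_pCons AB unfolding sq by (simp add: algebra_simps power2_eq_square)
  qed
qed

text \<open>
  The polynomials \<open>\<Prod>i<k. X - (i + 1/2)\<^sup>2\<close> in \<open>X = l\<^sup>2\<close> are, up to a constant and the factor \<open>l\<close>,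
  the central differences of \<open>\<Prod>i\<le>k. X - i\<^sup>2\<close>; the induction is Newton interpolation in this basis.
\<close>

lemma central_difference_prod:
  "(\<Prod>i\<le>k. (l + 1/2)\<^sup>2 - (of_nat i)\<^sup>2) - (\<Prod>i\<le>k. (l - 1/2)\<^sup>2 - (of_nat i)\<^sup>2)
    = 2 * of_nat (Suc k) * l * (\<Prod>i<k. l\<^sup>2 - (of_nat i + 1/2)\<^sup>2)"
  for l :: complex
proof -
  have plus: "(\<Prod>i\<le>k. (l + 1/2)\<^sup>2 - (of_nat i)\<^sup>2)
      = (l + 1/2) * (l + 1/2 + of_nat k) * (\<Prod>i<k. l\<^sup>2 - (of_nat i + 1/2)\<^sup>2)" for l :: complex
  proof (induction k)
    case (Suc k)
    have sq: "a\<^sup>2 - b\<^sup>2 = (a + b) * (a - b)" for a b :: complex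
      by (simp add: power2_eq_square algebra_simps)
    have "(l + 1/2)\<^sup>2 - (of_nat (Suc k))\<^sup>2
      = (l + 1/2 + of_nat (Suc k)) * (l - (of_nat k + 1/2))"
      unfolding sq by simp
    moreover have "l\<^sup>2 - (of_nat k + 1/2)\<^sup>2 = (l + 1/2 + of_nat k) * (l - (of_nat k + 1/2))"
      unfolding sq by (simp add: add_ac)
    ultimately show ?case
      by (simp add: Suc mult_ac del: of_nat_Suc)
  qed (simp add: power2_eq_square)
  \<comment> \<open>The other half shift is the same identity at -l.\<close>
  have "(\<Prod>i\<le>k. (l - 1/2)\<^sup>2 - (of_nat i)\<^sup>2)
      = (l - 1/2) * (l - 1/2 - of_nat k) * (\<Prod>i<k. l\<^sup>2 - (of_nat i + 1/2)\<^sup>2)"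
    using plus[of "- l"] by (simp add: power2_eq_square algebra_simps)
  then show ?thesis
    unfolding plus by (simp add: algebra_simps)
qed

lemma ex_central_antidifference_const:
  "\<exists>G. \<forall>l :: complex. poly G ((l + 1/2)\<^sup>2) - poly G ((l - 1/2)\<^sup>2)
     = l * (\<Prod>i<k. l\<^sup>2 - (of_nat i + 1/2)\<^sup>2) * c"
proof -
  let ?c = "c / (2 * of_nat (Suc k))"
  let ?G = "Polynomial.smult ?c (\<Prod>i\<le>k. [:- (of_nat i)\<^sup>2, 1:])"
  have G: "poly ?G u = ?c * (\<Prod>i\<le>k. u - (of_nat i)\<^sup>2)" for u
    by (simp add: poly_prod)
  have "2 * complex_of_nat (Suc k) \<noteq> 0"
    by (simp del: of_nat_Suc)
  then have "poly ?G ((l + 1/2)\<^sup>2) - poly ?G ((l - 1/2)\<^sup>2)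
     = l * (\<Prod>i<k. l\<^sup>2 - (of_nat i + 1/2)\<^sup>2) * c" for l
    unfolding G right_diff_distrib[symmetric] central_difference_prod by simp
  then show ?thesis by blast
qed

lemma ex_central_antidifference_prod:
  "\<exists>G. \<forall>l :: complex. poly G ((l + 1/2)\<^sup>2) - poly G ((l - 1/2)\<^sup>2)
     = l * (\<Prod>i<k. l\<^sup>2 - (of_nat i + 1/2)\<^sup>2) * poly P (l\<^sup>2)"
proof (induction "Polynomial.degree P" arbitrary: P k)
  case 0
  then obtain c where P: "P = [:c:]"
    by (metis degree_eq_zeroE)
  then show ?case
    using ex_central_antidifference_const[of k c] by simp
next
  case (Suc d)
  let ?x = "(of_nat k + 1/2 :: complex)\<^sup>2"
  \<comment> \<open>Division at the k-th Newton node: the quotient has smaller degree and the node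
    factor joins the product, which is why k varies in the induction.\<close>
  define R where "R = synthetic_div P ?x"
  have P: "poly P u = poly P ?x + (u - ?x) * poly R u" for u
    using arg_cong[OF synthetic_div_correct[of P ?x], of "\<lambda>p. poly p u"]
    by (simp add: R_def algebra_simps)
  have "Polynomial.degree R = d"
    using Suc(2) by (simp add: R_def degree_synthetic_div)
  then have "\<exists>G1. \<forall>l. poly G1 ((l + 1/2)\<^sup>2) - poly G1 ((l - 1/2)\<^sup>2)
     = l * (\<Prod>i<Suc k. l\<^sup>2 - (of_nat i + 1/2)\<^sup>2) * poly R (l\<^sup>2)"
    by (intro Suc(1)) simp
  then obtain G1 where G1: "\<forall>l. poly G1 ((l + 1/2)\<^sup>2) - poly G1 ((l - 1/2)\<^sup>2)
     = l * (\<Prod>i<Suc k. l\<^sup>2 - (of_nat i + 1/2)\<^sup>2) * poly R (l\<^sup>2)"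
    by (elim exE)
  obtain G0 where G0: "\<forall>l. poly G0 ((l + 1/2)\<^sup>2) - poly G0 ((l - 1/2)\<^sup>2)
     = l * (\<Prod>i<k. l\<^sup>2 - (of_nat i + 1/2)\<^sup>2) * poly P ?x"
    using ex_central_antidifference_const[of k "poly P ?x"] by (elim exE)
  show ?case
  proof (rule exI[of _ "G0 + G1"], rule allI)
    fix l :: complex
    have "poly (G0 + G1) ((l + 1/2)\<^sup>2) - poly (G0 + G1) ((l - 1/2)\<^sup>2)
      = (poly G0 ((l + 1/2)\<^sup>2) - poly G0 ((l - 1/2)\<^sup>2))
        + (poly G1 ((l + 1/2)\<^sup>2) - poly G1 ((l - 1/2)\<^sup>2))"
      by simp
    also have "\<dots> = l * (\<Prod>i<k. l\<^sup>2 - (of_nat i + 1/2)\<^sup>2) * (poly P ?x + (l\<^sup>2 - ?x) * poly R (l\<^sup>2))"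
      unfolding G0[rule_format] G1[rule_format] by (simp add: distrib_left mult_ac)
    also have "poly P ?x + (l\<^sup>2 - ?x) * poly R (l\<^sup>2) = poly P (l\<^sup>2)"
      using P[of "l\<^sup>2"] by simp
    finally show "poly (G0 + G1) ((l + 1/2)\<^sup>2) - poly (G0 + G1) ((l - 1/2)\<^sup>2)
      = l * (\<Prod>i<k. l\<^sup>2 - (of_nat i + 1/2)\<^sup>2) * poly P (l\<^sup>2)" .
  qed
qed

lemma ex_central_antidifference:
  "\<exists>G. \<forall>l :: complex. poly G ((l + 1/2)\<^sup>2) - poly G ((l - 1/2)\<^sup>2) = l * poly P (l\<^sup>2)"
  using ex_central_antidifference_prod[where k = 0] by simp


section \<open>The lattice representation\<close>

text \<open>
  Functions on \<open>\<int>\<^sup>2\<close> are formal combinations of vectors \<open>v(a, b)\<close> on which the Casimir element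
  \<open>(h + 1)\<^sup>2 + 4 f e\<close> acts by \<open>l\<^sup>2\<close>, where \<open>l = a - b + 1/2\<close>, and \<open>h\<close> acts by \<open>a + b\<close>.  The half
  integer keeps the denominators \<open>l\<close> away from zero.  The operators \<open>x\<close> and \<open>y\<close> shift \<open>l\<close> by
  \<open>\<plusminus>1\<close>; the relation for \<open>[x, y]\<close> determines only the differences in \<open>l\<close> of the coefficient
  \<open>t + G((l - 1/2)\<^sup>2)\<close>, so the parameter \<open>t\<close> is free.
\<close>

type_synonym lattice_fun = "int \<Rightarrow> int \<Rightarrow> complex"

text \<open>Kept opaque, so that the ring normalisation of the relations meets no fractions.\<close>

definition quarter :: complex where "quarter = 1/4"

definition raise_coeff :: "int \<Rightarrow> complex" where
  "raise_coeff n = 1 / (of_int n + 1/2)"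

definition lower_coeff :: "complex poly \<Rightarrow> complex \<Rightarrow> int \<Rightarrow> complex" where
  "lower_coeff G t n = (t + poly G ((of_int n)\<^sup>2)) / (of_int n + 1/2)"

fun act_gen :: "complex poly \<Rightarrow> complex \<Rightarrow> hecke_gen \<Rightarrow> lattice_fun \<Rightarrow> lattice_fun" where
  "act_gen G t (Inl Sl2_e) \<phi> = (\<lambda>a b. \<phi> (a - 1) (b - 1))"
| "act_gen G t (Inl Sl2_h) \<phi> = (\<lambda>a b. of_int (a + b) * \<phi> a b)"
| "act_gen G t (Inl Sl2_f) \<phi> =
     (\<lambda>a b. - (of_int a + 1 - quarter) * (of_int b + quarter) * \<phi> (a + 1) (b + 1))"
| "act_gen G t (Inr V_x) \<phi> =
     (\<lambda>a b. raise_coeff (a - b - 1) * \<phi> (a - 1) b + lower_coeff G t (a - b + 1) * \<phi> a (b - 1))"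
| "act_gen G t (Inr V_y) \<phi> =
     (\<lambda>a b. - (of_int b + quarter) * raise_coeff (a - b - 1) * \<phi> a (b + 1)
        - (of_int a + 1 - quarter) * lower_coeff G t (a - b + 1) * \<phi> (a + 1) b)"

definition act :: "complex poly \<Rightarrow> complex \<Rightarrow> hecke_gen list \<Rightarrow> lattice_fun \<Rightarrow> lattice_fun" where
  "act G t = foldr (act_gen G t)"

lemma act_Nil [simp]: "act G t [] \<phi> = \<phi>"
  and act_Cons [simp]: "act G t (g # w) \<phi> = act_gen G t g (act G t w \<phi>)"
  and act_append: "act G t (u @ w) \<phi> = act G t u (act G t w \<phi>)"
  by (simp_all add: act_def)

lemma act_gen_add:
  "act_gen G t g (\<lambda>a b. \<phi> a b + \<psi> a b) = (\<lambda>a b. act_gen G t g \<phi> a b + act_gen G t g \<psi> a b)"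
  by (cases "(G, t, g, \<phi>)" rule: act_gen.cases) (auto simp: algebra_simps add_divide_distrib)

lemma act_gen_scale: "act_gen G t g (\<lambda>a b. c * \<phi> a b) = (\<lambda>a b. c * act_gen G t g \<phi> a b)"
  by (cases "(G, t, g, \<phi>)" rule: act_gen.cases) (auto simp: algebra_simps)

lemma act_add: "act G t w (\<lambda>a b. \<phi> a b + \<psi> a b) = (\<lambda>a b. act G t w \<phi> a b + act G t w \<psi> a b)"
  by (induction w) (simp_all add: act_gen_add)

lemma act_scale: "act G t w (\<lambda>a b. c * \<phi> a b) = (\<lambda>a b. c * act G t w \<phi> a b)"
  by (induction w) (simp_all add: act_gen_scale)

definition rep :: "complex poly \<Rightarrow> complex \<Rightarrow> hecke_gen free_alg \<Rightarrow> lattice_fun \<Rightarrow> lattice_fun" where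
  "rep G t p \<phi> =
     (\<lambda>a b. \<Sum>w\<in>Poly_Mapping.keys p. Poly_Mapping.lookup p w * act G t w \<phi> a b)"

lemma rep_eq_sum:
  assumes "finite A" "Poly_Mapping.keys p \<subseteq> A"
  shows "rep G t p \<phi> = (\<lambda>a b. \<Sum>w\<in>A. Poly_Mapping.lookup p w * act G t w \<phi> a b)"
  unfolding rep_def using assms
  by (intro ext sum.mono_neutral_left) (auto simp: in_keys_iff)

lemma rep_single [simp]: "rep G t (Poly_Mapping.single w c) \<phi> = (\<lambda>a b. c * act G t w \<phi> a b)"
  by (simp add: rep_eq_sum[of "{w}"])

lemma rep_0 [simp]: "rep G t 0 \<phi> = (\<lambda>a b. 0)"
  by (simp add: rep_def)

lemma rep_1 [simp]: "rep G t 1 \<phi> = \<phi>"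
  by (simp add: one_free_alg)

lemma rep_scalar [simp]: "rep G t (scalar c) \<phi> = (\<lambda>a b. c * \<phi> a b)"
  by (simp add: scalar_def)

lemma rep_gen [simp]: "rep G t (gen g) \<phi> = act_gen G t g \<phi>"
  by (simp add: gen_def)

lemma rep_add: "rep G t (p + q) \<phi> = (\<lambda>a b. rep G t p \<phi> a b + rep G t q \<phi> a b)"
proof -
  let ?A = "Poly_Mapping.keys p \<union> Poly_Mapping.keys q"
  have "finite ?A" "Poly_Mapping.keys (p + q) \<subseteq> ?A"
    using keys_add[of p q] by auto
  then show ?thesis
    by (simp add: rep_eq_sum[of ?A] lookup_add distrib_right sum.distrib)
qed

lemma rep_fun_add:
  "rep G t p (\<lambda>a b. \<phi> a b + \<psi> a b) = (\<lambda>a b. rep G t p \<phi> a b + rep G t p \<psi> a b)"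
  by (simp add: rep_def act_add distrib_left sum.distrib)

lemma rep_fun_scale: "rep G t p (\<lambda>a b. c * \<phi> a b) = (\<lambda>a b. c * rep G t p \<phi> a b)"
  by (simp add: rep_def act_scale sum_distrib_left mult.left_commute)

lemma rep_fun_0 [simp]: "rep G t p (\<lambda>a b. 0) = (\<lambda>a b. 0)"
  using rep_fun_scale[of G t p 0 "\<lambda>a b. 0"] by simp

lemma rep_mult: "rep G t (p * q) \<phi> = rep G t p (rep G t q \<phi>)"
proof (induction p rule: free_alg_induct)
  case (single u c)
  show ?case
  proof (induction q rule: free_alg_induct)
    case (single v d)
    show ?case
      by (simp add: mult_single_list act_append act_scale mult.assoc)
  qed (simp_all only: distrib_left rep_add rep_fun_add mult_zero_right rep_0 rep_fun_0)
qed (simp_all add: distrib_right rep_add)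

lemma rep_uminus: "rep G t (- p) \<phi> = (\<lambda>a b. - rep G t p \<phi> a b)"
  using rep_add[of G t p "- p" \<phi>]
  by (simp add: fun_eq_iff eq_neg_iff_add_eq_0 add.commute)

lemma rep_diff: "rep G t (p - q) \<phi> = (\<lambda>a b. rep G t p \<phi> a b - rep G t q \<phi> a b)"
  by (simp add: rep_add rep_uminus diff_conv_add_uminus del: add_uminus_conv_diff)

lemma rep_sum: "rep G t (\<Sum>i\<in>A. p i) \<phi> = (\<lambda>a b. \<Sum>i\<in>A. rep G t (p i) \<phi> a b)"
  by (induction A rule: infinite_finite_induct) (simp_all add: rep_add)

lemmas rep_simps = rep_add rep_diff rep_uminus rep_mult rep_sum

lemma rep_numeral [simp]: "rep G t (numeral n) \<phi> = (\<lambda>a b. numeral n * \<phi> a b)"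
  by (simp flip: scalar_numeral)

lemma rep_kernel_ideal: "free_ideal {p. \<forall>\<phi>. rep G t p \<phi> = (\<lambda>a b. 0)}"
  by unfold_locales (auto simp: rep_simps)

lemma half_integer_nonzero: "of_int n + 1/2 \<noteq> (0 :: complex)"
proof
  assume "of_int n + 1/2 = (0 :: complex)"
  then have "2 * (of_int n + 1/2) = (0 :: complex)"
    by (simp only: mult_zero_right)
  then have "of_int (2 * n + 1) = (of_int 0 :: complex)"
    by (simp add: distrib_left)
  then have "2 * n + 1 = 0"
    by (simp only: of_int_eq_iff)
  then show False by presburger
qed

lemma rep_commutator:
  "rep G t (commutator p q) \<phi> = (\<lambda>a b. rep G t p (rep G t q \<phi>) a b - rep G t q (rep G t p \<phi>) a b)"
  by (simp add: commutator_def rep_simps)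

lemma rep_bracket:
  "rep G t (commutator (gen (Inl Sl2_h)) (gen (Inl Sl2_e)) - 2 * gen (Inl Sl2_e)) \<phi> = (\<lambda>a b. 0)"
  "rep G t (commutator (gen (Inl Sl2_h)) (gen (Inl Sl2_f)) + 2 * gen (Inl Sl2_f)) \<phi> = (\<lambda>a b. 0)"
  "rep G t (commutator (gen (Inl Sl2_e)) (gen (Inl Sl2_f)) - gen (Inl Sl2_h)) \<phi> = (\<lambda>a b. 0)"
  "rep G t (commutator (gen (Inl Sl2_e)) (gen (Inr V_x))) \<phi> = (\<lambda>a b. 0)"
  "rep G t (commutator (gen (Inl Sl2_e)) (gen (Inr V_y)) - gen (Inr V_x)) \<phi> = (\<lambda>a b. 0)"
  "rep G t (commutator (gen (Inl Sl2_f)) (gen (Inr V_x)) - gen (Inr V_y)) \<phi> = (\<lambda>a b. 0)"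
  "rep G t (commutator (gen (Inl Sl2_f)) (gen (Inr V_y))) \<phi> = (\<lambda>a b. 0)"
  "rep G t (commutator (gen (Inl Sl2_h)) (gen (Inr V_x)) - gen (Inr V_x)) \<phi> = (\<lambda>a b. 0)"
  "rep G t (commutator (gen (Inl Sl2_h)) (gen (Inr V_y)) + gen (Inr V_y)) \<phi> = (\<lambda>a b. 0)"
  by (intro ext, simp only: rep_simps rep_commutator rep_gen act_gen.simps rep_numeral,
      simp add: algebra_simps)+

lemma rep_sl2_relations:
  assumes "p \<in> sl2_relations"
  shows "rep G t (map_free Inl p) \<phi> = (\<lambda>a b. 0)"
  using assms rep_bracket(1-3)[of G t \<phi>] unfolding sl2_relations_def Let_def
  by (auto simp only: commutator_def map_free_diff map_free_add map_free_numeral map_free_mult map_free_gen)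

text \<open>In xy - yx the parts moving l by 2 cancel. On v(a, b) there remains the path up and back
  minus the path down and back, which is the difference of the two values of G divided by l; the
  parameter t drops out.\<close>

lemma rep_commutator_x_y:
  assumes "\<And>l. poly G ((l + 1/2)\<^sup>2) - poly G ((l - 1/2)\<^sup>2) = l * poly P (l\<^sup>2)"
  shows "rep G t (commutator (gen (Inr V_x)) (gen (Inr V_y))) \<phi>
    = (\<lambda>a b. poly P ((of_int (a - b) + 1/2)\<^sup>2) * \<phi> a b)"
proof (intro ext)
  fix a b
  let ?n = "a - b" and ?l = "of_int (a - b) + 1/2 :: complex"
  have nz: "?l \<noteq> 0" "?l + 1 \<noteq> 0" "?l - 1 \<noteq> 0"
    using half_integer_nonzero[of ?n] half_integer_nonzero[of "?n + 1"]
      half_integer_nonzero[of "?n - 1"] by (simp_all add: add_ac diff_add_eq)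
  have coeffs: "raise_coeff ?n = 1 / ?l" "raise_coeff (?n - 1) = 1 / (?l - 1)"
      "lower_coeff G t ?n = (t + poly G ((?l - 1/2)\<^sup>2)) / ?l"
      "lower_coeff G t (?n + 1) = (t + poly G ((?l + 1/2)\<^sup>2)) / (?l + 1)"
    by (simp_all add: raise_coeff_def lower_coeff_def add_ac diff_add_eq)
  have "rep G t (commutator (gen (Inr V_x)) (gen (Inr V_y))) \<phi> a b
    = (raise_coeff ?n * lower_coeff G t (?n + 1) * (?l + 1)
       - lower_coeff G t ?n * raise_coeff (?n - 1) * (?l - 1)) * \<phi> a b"
  proof -
    have "rep G t (commutator (gen (Inr V_x)) (gen (Inr V_y))) \<phi> a b
      = (raise_coeff ?n * lower_coeff G t (?n + 1) * (of_int a + 1 - (of_int b + quarter) + (1 - quarter))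
       - lower_coeff G t ?n * raise_coeff (?n - 1) * (of_int a - (of_int b + quarter) - quarter)) * \<phi> a b"
      by (simp add: commutator_def rep_simps) (simp add: algebra_simps)
    moreover have "of_int a + 1 - (of_int b + quarter) + (1 - quarter) = ?l + 1"
      "of_int a - (of_int b + quarter) - quarter = ?l - 1"
      by (simp_all add: quarter_def)
    ultimately show ?thesis
      by (simp only:)
  qed
  also have "\<dots> = (poly G ((?l + 1/2)\<^sup>2) - poly G ((?l - 1/2)\<^sup>2)) / ?l * \<phi> a b"
  proof -
    have "1 / l * (p / l1) * l1 - q / l * (1 / l2) * l2 = (p - q) / l"
      if "l1 \<noteq> 0" "l2 \<noteq> 0" for l l1 l2 p q :: complex
      using that by (simp add: diff_divide_distrib)
    from this[OF nz(2,3)] show ?thesis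
      unfolding coeffs by simp
  qed
  also have "\<dots> = poly P (?l\<^sup>2) * \<phi> a b"
    unfolding assms using nz by simp
  finally show "rep G t (commutator (gen (Inr V_x)) (gen (Inr V_y))) \<phi> a b
    = poly P (?l\<^sup>2) * \<phi> a b" .
qed


section \<open>Central elements of the enveloping algebra act by polynomials in the Casimir element\<close>

text \<open>The outer variable is the weight and the inner one the Casimir eigenvalue. In these
  coordinates shifting a and b together, as e and f do, changes only the outer variable.\<close>

definition eval_lattice :: "complex poly poly \<Rightarrow> int \<Rightarrow> int \<Rightarrow> complex" where
  "eval_lattice F a b = poly (poly F [:of_int (a + b):]) ((of_int (a - b) + 1/2)\<^sup>2)"

lemma eval_lattice_add [simp]: "eval_lattice (F + F') a b = eval_lattice F a b + eval_lattice F' a b"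
  and eval_lattice_mult [simp]: "eval_lattice (F * F') a b = eval_lattice F a b * eval_lattice F' a b"
  and eval_lattice_0 [simp]: "eval_lattice 0 a b = 0"
  and eval_lattice_const [simp]: "eval_lattice [:[:c:]:] a b = c"
  by (simp_all add: eval_lattice_def)

lemma eval_lattice_pcompose_shift:
  "eval_lattice (F \<circ>\<^sub>p [:[:of_int (2 * s):], 1:]) a b = eval_lattice F (a + s) (b + s)"
proof -
  have "[:of_int (2 * s) + of_int (a + b) :: complex:] = [:of_int ((a + s) + (b + s)):]"
    by (simp add: algebra_simps)
  then show ?thesis
    by (simp add: eval_lattice_def poly_pcompose)
qed

text \<open>Words in e, f, h move along a diagonal, where l is fixed, with coefficients polynomial
  in the weight and \<open>l^2\<close>. Quantifying over \<open>G\<close> and \<open>t\<close>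
  inside records that U(sl2) acts in the same way in the whole family.\<close>

lemma act_sl2_word:
  "\<exists>s F. \<forall>G t \<phi> a b. act G t (map Inl u) \<phi> a b = eval_lattice F a b * \<phi> (a - s) (b - s)"
proof (induction u)
  case Nil
  show ?case by (intro exI[of _ 0] exI[of _ "[:[:1:]:]"]) simp
next
  case (Cons g u)
  then obtain s F where F: "\<forall>G t \<phi> a b. act G t (map Inl u) \<phi> a b = eval_lattice F a b * \<phi> (a - s) (b - s)"
    by (elim exE)
  show ?case
  proof (cases g)
    case Sl2_e
    show ?thesis
      by (rule exI[of _ "s + 1"], rule exI[of _ "F \<circ>\<^sub>p [:[:of_int (2 * (-1)):], 1:]"])
         (simp only: eval_lattice_pcompose_shift, simp add: Sl2_e F algebra_simps)
  next
    case Sl2_h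
    have "eval_lattice [:0, 1:] a b = of_int (a + b)" for a b
      by (simp add: eval_lattice_def)
    then show ?thesis
      by (intro exI[of _ s] exI[of _ "[:0, 1:] * F"])
         (simp only: eval_lattice_mult, simp add: Sl2_h F algebra_simps)
  next
    case Sl2_f
    \<comment> \<open>With w the weight a + b, the coefficient of f is (l^2 - (w+1)^2)/4, because
      (h+1)^2 + 4fe acts by l^2.\<close>
    let ?K = "[:[:- quarter, quarter:], [:- 2 * quarter:], [:- quarter:]:]"
    have K: "eval_lattice ?K a b = - (of_int a + 1 - quarter) * (of_int b + quarter)" for a b
    proof -
      have "eval_lattice ?K a b = quarter * ((of_int (a - b) + 1/2)\<^sup>2 - (of_int (a + b) + 1)\<^sup>2)"
        by (simp add: eval_lattice_def power2_eq_square algebra_simps)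
      also have "(of_int (a - b) + 1/2)\<^sup>2 - (of_int (a + b) + 1)\<^sup>2
          = - 4 * ((of_int a + 1 - quarter) * (of_int b + quarter))"
      proof -
        have "x\<^sup>2 - y\<^sup>2 = (x + y) * (x - y)" for x y :: complex
          by (simp add: power2_eq_square algebra_simps)
        then have "(of_int (a - b) + 1/2)\<^sup>2 - (of_int (a + b) + 1 :: complex)\<^sup>2
          = (2 * (of_int a + 1 - quarter)) * (- 2 * (of_int b + quarter))"
          by (simp add: quarter_def)
        also have "\<dots> = - 4 * ((of_int a + 1 - quarter) * (of_int b + quarter))"
          by (simp add: algebra_simps)
        finally show ?thesis .
      qed
      also have "quarter * (- 4 * ((of_int a + 1 - quarter) * (of_int b + quarter)))
          = (4 * quarter) * (- (of_int a + 1 - quarter) * (of_int b + quarter))"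
        by (simp only: mult_ac mult_minus_left mult_minus_right)
      also have "4 * quarter = 1"
        by (simp add: quarter_def)
      finally show ?thesis by (simp only: mult_1_left)
    qed
    show ?thesis
      by (rule exI[of _ "s - 1"], rule exI[of _ "?K * (F \<circ>\<^sub>p [:[:of_int (2 * 1):], 1:])"])
         (simp only: eval_lattice_mult eval_lattice_pcompose_shift K, simp add: Sl2_f F algebra_simps)
  qed
qed

lemma rep_sl2:
  "\<exists>S F. finite S \<and> (\<forall>s. s \<notin> S \<longrightarrow> F s = 0) \<and>
     (\<forall>G t \<phi> a b. rep G t (map_free Inl p) \<phi> a b
       = (\<Sum>s\<in>S. eval_lattice (F s) a b * \<phi> (a - s) (b - s)))"
proof (induction p rule: free_alg_induct)
  case zero
  show ?case by (intro exI[of _ "{}"] exI[of _ "\<lambda>_. 0"]) simp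
next
  case (add p q)
  from add(1) obtain S F where 1: "finite S" "\<forall>s. s \<notin> S \<longrightarrow> F s = 0"
    "\<forall>G t \<phi> a b. rep G t (map_free Inl p) \<phi> a b
       = (\<Sum>s\<in>S. eval_lattice (F s) a b * \<phi> (a - s) (b - s))"
    by (elim exE conjE)
  from add(2) obtain S' F' where 2: "finite S'" "\<forall>s. s \<notin> S' \<longrightarrow> F' s = 0"
    "\<forall>G t \<phi> a b. rep G t (map_free Inl q) \<phi> a b
       = (\<Sum>s\<in>S'. eval_lattice (F' s) a b * \<phi> (a - s) (b - s))"
    by (elim exE conjE)
  have "(\<Sum>s\<in>S. eval_lattice (F s) a b * \<phi> (a - s) (b - s))
      = (\<Sum>s\<in>S \<union> S'. eval_lattice (F s) a b * \<phi> (a - s) (b - s))"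
    "(\<Sum>s\<in>S'. eval_lattice (F' s) a b * \<phi> (a - s) (b - s))
      = (\<Sum>s\<in>S \<union> S'. eval_lattice (F' s) a b * \<phi> (a - s) (b - s))" for a b \<phi>
    using 1(1,2) 2(1,2) by (intro sum.mono_neutral_left; force)+
  then show ?case
    using 1 2
    by (intro exI[of _ "S \<union> S'"] exI[of _ "\<lambda>s. F s + F' s"])
       (simp add: map_free_add rep_add distrib_right sum.distrib)
next
  case (single u c)
  obtain s F where F: "\<forall>G t \<phi> a b. act G t (map Inl u) \<phi> a b = eval_lattice F a b * \<phi> (a - s) (b - s)"
    using act_sl2_word[of u] by (elim exE)
  show ?case
    by (intro exI[of _ "{s}"] exI[of _ "\<lambda>s'. [:[:c:]:] * (if s' = s then F else 0)"] conjI allI)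
       (simp_all only: eval_lattice_mult eval_lattice_const, simp_all add: F)
qed

lemma poly_map_poly_poly:
  "poly (map_poly (\<lambda>q. poly q y) F) x = poly (poly F [:x:]) y"
  by (induction F) (simp_all add: map_poly_pCons)

text \<open>For fixed l, a shift-invariant polynomial in the weight takes one value at infinitely
  many weights, so it is constant and may be evaluated at weight 0, even when parity keeps weight 0
  off the lattice line.\<close>

lemma eval_lattice_invariant:
  assumes "\<And>a b. eval_lattice F (a - 1) (b - 1) = eval_lattice F a b"
  shows "eval_lattice F a b = poly (poly F 0) ((of_int (a - b) + 1/2)\<^sup>2)"
proof -
  define n where "n = a - b"
  define g where "g = map_poly (\<lambda>q. poly q ((of_int n + 1/2)\<^sup>2)) F"
  have g: "poly g (of_int (n + 2 * k)) = eval_lattice F (n + k) k" for k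
    by (simp add: g_def poly_map_poly_poly eval_lattice_def algebra_simps)
  have const: "eval_lattice F (n + int k) (int k) = eval_lattice F n 0" for k
    using assms[of "n + int (Suc k)" "int (Suc k)" for k]
    by (induction k) (simp_all add: algebra_simps)
  have shift: "eval_lattice F (n + k) k = eval_lattice F n 0" for k
  proof (cases "k \<ge> 0")
    case True
    then show ?thesis using const[of "nat k"] by simp
  next
    case False
    have "eval_lattice F (n + (k + int j)) (k + int j) = eval_lattice F (n + k) k" for j
      using assms[of "n + (k + int (Suc j))" "k + int (Suc j)" for j]
      by (induction j) (simp_all add: algebra_simps)
    from this[of "nat (- k)"] False show ?thesis by simp
  qed
  define c where "c = eval_lattice F n 0"
  have "range (\<lambda>k. of_int (n + 2 * k)) \<subseteq> {x. poly (g - [:c:]) x = 0}"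
    using g shift by (auto simp: c_def)
  moreover have "infinite (range (\<lambda>k. of_int (n + 2 * k) :: complex))"
    by (subst finite_image_iff) (auto intro!: injI simp del: of_int_add of_int_mult)
  ultimately have "g - [:c:] = 0"
    using poly_roots_finite finite_subset by blast
  then have "poly g 0 = c" by simp
  then show ?thesis
    using shift[of b] by (simp add: g_def poly_map_poly_poly c_def n_def)
qed

lemma U_sl2_center_commutes:
  assumes "z \<in> ring_center U_sl2" "w \<in> z"
  shows "w * q - q * w \<in> genideal free_ring sl2_relations"
    and "w' \<in> z \<Longrightarrow> w - w' \<in> genideal free_ring sl2_relations"
proof -
  interpret free_ideal "genideal free_ring sl2_relations"
    by (rule free_ideal_genideal)
  obtain p where z: "z = genideal free_ring sl2_relations +>\<^bsub>free_ring\<^esub> p"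
    using assms(1) unfolding ring_center_def U_sl2_def by (auto simp: carrier_free_Quot)
  have in_z: "v - p \<in> genideal free_ring sl2_relations" if "v \<in> z" for v
    using that by (auto simp: z coset_free_ring)
  then have w: "z = genideal free_ring sl2_relations +>\<^bsub>free_ring\<^esub> w"
    using assms(2) unfolding z coset_eq_iff using diff_mem uminus_mem
    by (metis (no_types, lifting) minus_diff_eq)
  then show "w * q - q * w \<in> genideal free_ring sl2_relations"
    using assms(1) unfolding U_sl2_def by (simp add: coset_in_ring_center_iff)
  show "w - w' \<in> genideal free_ring sl2_relations" if "w' \<in> z"
    using diff_mem[OF in_z[OF assms(2)] in_z[OF that]] by simp
qed

lemma rep_sl2_ideal:
  assumes "p \<in> genideal free_ring sl2_relations"
  shows "rep G t (map_free Inl p) \<phi> = (\<lambda>a b. 0)"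
proof -
  have "free_ideal {p :: sl2_basis free_alg. \<forall>\<phi>. rep G t (map_free Inl p) \<phi> = (\<lambda>a b. 0)}"
    by unfold_locales (auto simp: map_free_add map_free_mult rep_simps)
  then have "genideal free_ring sl2_relations \<subseteq> {p. \<forall>\<phi>. rep G t (map_free Inl p) \<phi> = (\<lambda>a b. 0)}"
    by (rule genideal_least) (use rep_sl2_relations in auto)
  with assms show ?thesis by auto
qed

text \<open>Commuting with h kills the components that change the weight, and commuting with e makes
  the remaining diagonal coefficient invariant along diagonals, hence a function of
  \<open>l^2\<close> alone. This plays the role of the description of the center of U(sl2) by the
  Casimir element.\<close>

lemma rep_U_sl2_center:
  assumes "z \<in> ring_center U_sl2"
  obtains P where "\<And>w G t \<phi>. w \<in> z \<Longrightarrow>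
    rep G t (map_free Inl w) \<phi> = (\<lambda>a b. poly P ((of_int (a - b) + 1/2)\<^sup>2) * \<phi> a b)"
proof -
  interpret I: free_ideal "genideal free_ring sl2_relations"
    by (rule free_ideal_genideal)
  obtain p where z: "z = genideal free_ring sl2_relations +>\<^bsub>free_ring\<^esub> p"
    using assms(1) unfolding ring_center_def U_sl2_def by (auto simp: carrier_free_Quot)
  have p: "p \<in> z"
    using I.zero_mem unfolding z coset_free_ring by (auto intro: exI[of _ 0])
  obtain S F where SF: "finite S" "\<forall>s. s \<notin> S \<longrightarrow> F s = 0"
    "\<forall>G t \<phi> a b. rep G t (map_free Inl p) \<phi> a b
       = (\<Sum>s\<in>S. eval_lattice (F s) a b * \<phi> (a - s) (b - s))"
    using rep_sl2[of p] by (elim exE conjE)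
  have comm: "rep G t (map_free Inl p) (act_gen G t (Inl g) \<phi>) = act_gen G t (Inl g) (rep G t (map_free Inl p) \<phi>)"
    for G t \<phi> g
    using rep_sl2_ideal[OF U_sl2_center_commutes(1)[OF assms p, of "gen g"], of G t \<phi>]
    by (simp add: map_free_diff map_free_mult rep_simps fun_eq_iff)
  have off: "eval_lattice (F s) a b = 0" if "s \<noteq> 0" for s a b
  proof -
    \<comment> \<open>The basis vector that the component of shift s carries to (a, b); its weight
      differs from a + b by 2s.\<close>
    let ?\<delta> = "\<lambda>a' b'. if a' = a - s \<and> b' = b - s then 1 else 0 :: complex"
    have "(\<Sum>s'\<in>S. eval_lattice (F s') a b * (c * ?\<delta> (a - s') (b - s')))
        = (if s \<in> S then eval_lattice (F s) a b * c else 0)" for c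
    proof -
      have "(\<Sum>s'\<in>S. eval_lattice (F s') a b * (c * ?\<delta> (a - s') (b - s')))
        = (\<Sum>s'\<in>S. if s' = s then eval_lattice (F s) a b * c else 0)"
        by (rule sum.cong) auto
      then show ?thesis using SF(1) by simp
    qed
    note sums = this this[of 1, unfolded mult_1_left mult_1_right]
    have "act_gen 0 0 (Inl Sl2_h) ?\<delta> = (\<lambda>a' b'. of_int (a + b - 2 * s) * ?\<delta> a' b')"
      by (auto simp: fun_eq_iff)
    then have "of_int (a + b - 2 * s) * (if s \<in> S then eval_lattice (F s) a b else 0)
      = of_int (a + b) * (if s \<in> S then eval_lattice (F s) a b else 0)"
      using fun_cong[OF fun_cong[OF comm[of 0 0 Sl2_h ?\<delta>]], of a b]
      by (simp only: rep_fun_scale act_gen.simps SF(3)[rule_format] sums)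
    then have "(if s \<in> S then eval_lattice (F s) a b else 0) = 0"
      using that by (simp add: algebra_simps)
    then show ?thesis
      using SF(2) by (auto split: if_splits)
  qed
  have diag: "rep G t (map_free Inl p) \<phi> a b = eval_lattice (F 0) a b * \<phi> a b" for G t \<phi> a b
  proof -
    have "(\<Sum>s\<in>S. eval_lattice (F s) a b * \<phi> (a - s) (b - s))
      = (\<Sum>s\<in>S. if s = 0 then eval_lattice (F 0) a b * \<phi> a b else 0)"
      using off by (intro sum.cong) auto
    also have "\<dots> = eval_lattice (F 0) a b * \<phi> a b"
      using SF(1,2) by simp
    finally show ?thesis by (simp add: SF(3))
  qed
  \<comment> \<open>The constant function 1 is fixed by e, so comparing the two orders of
    application gives invariance of the coefficient.\<close>
  have "eval_lattice (F 0) (a - 1) (b - 1) = eval_lattice (F 0) a b" for a b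
    using fun_cong[OF fun_cong[OF comm[of 0 0 Sl2_e "\<lambda>_ _. 1"]], of a b] by (simp add: diag)
  note inv = eval_lattice_invariant[OF this]
  show thesis
  proof (rule that[of "poly (F 0) 0"])
    fix w G t \<phi> assume w: "w \<in> z"
    have "rep G t (map_free Inl w) \<phi> = rep G t (map_free Inl p) \<phi>"
      using rep_sl2_ideal[OF U_sl2_center_commutes(2)[OF assms w p], of G t \<phi>]
      by (simp add: map_free_diff rep_diff fun_eq_iff)
    then show "rep G t (map_free Inl w) \<phi> = (\<lambda>a b. poly (poly (F 0) 0) ((of_int (a - b) + 1/2)\<^sup>2) * \<phi> a b)"
      by (simp only: fun_eq_iff diag inv simp_thms)
  qed
qed


section \<open>The central element\<close>

definition alg_eval :: "complex poly \<Rightarrow> 'a free_alg \<Rightarrow> 'a free_alg" where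
  "alg_eval p c = (\<Sum>i\<le>Polynomial.degree p. scalar (poly.coeff p i) * c ^ i)"

lemma map_free_sum: "map_free f (\<Sum>i\<in>A. p i) = (\<Sum>i\<in>A. map_free f (p i))"
  by (induction A rule: infinite_finite_induct) (simp_all add: map_free_add)

lemma map_free_1 [simp]: "map_free f 1 = 1"
  using map_free_scalar[of f 1] by simp

lemma map_free_power: "map_free f (p ^ n) = map_free f p ^ n"
  by (induction n) (simp_all add: map_free_mult)

lemma map_free_alg_eval: "map_free f (alg_eval p c) = alg_eval p (map_free f c)"
  by (simp add: alg_eval_def map_free_sum map_free_mult map_free_power)

lemma rep_alg_eval:
  assumes "\<And>\<phi>. rep G t c \<phi> = (\<lambda>a b. u a b * \<phi> a b)"
  shows "rep G t (alg_eval p c) \<phi> = (\<lambda>a b. poly p (u a b) * \<phi> a b)"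
proof -
  have "rep G t (c ^ n) \<phi> = (\<lambda>a b. u a b ^ n * \<phi> a b)" for n
    by (induction n) (simp_all add: rep_mult assms mult.assoc)
  then show ?thesis
    by (simp add: alg_eval_def rep_sum rep_mult poly_altdef sum_distrib_right mult.assoc)
qed

context free_ideal
begin

text \<open>The derivation [g, _] modulo the ideal, as a relation, so that brackets of compound
  expressions are assembled by Leibniz introduction rules.\<close>

definition bracket_cong :: "'a free_alg \<Rightarrow> 'a free_alg \<Rightarrow> 'a free_alg \<Rightarrow> bool" where
  "bracket_cong g p q \<longleftrightarrow> g * p - p * g - q \<in> I"

lemma bracket_cong_mult:
  assumes "bracket_cong g p p'" "bracket_cong g q q'"
  shows "bracket_cong g (p * q) (p' * q + p * q')"
proof -
  have "g * (p * q) - p * q * g - (p' * q + p * q')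
    = (g * p - p * g - p') * q + p * (g * q - q * g - q')"
    by (simp add: algebra_simps)
  with assms show ?thesis
    by (simp add: bracket_cong_def add_mem mult_left_mem mult_right_mem)
qed

lemma bracket_cong_add:
  assumes "bracket_cong g p p'" "bracket_cong g q q'"
  shows "bracket_cong g (p + q) (p' + q')"
proof -
  have "g * (p + q) - (p + q) * g - (p' + q') = (g * p - p * g - p') + (g * q - q * g - q')"
    by (simp add: algebra_simps)
  with assms show ?thesis
    by (simp only: bracket_cong_def add_mem)
qed

lemma bracket_cong_scalar: "bracket_cong g (scalar c) 0"
  by (simp add: bracket_cong_def scalar_commute zero_mem)

lemma bracket_cong_1: "bracket_cong g 1 0"
  using bracket_cong_scalar[of g 1] by simp

lemma bracket_cong_numeral: "bracket_cong g (numeral n) 0"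
  using bracket_cong_scalar[of g "numeral n"] by (simp add: scalar_numeral)

lemma bracket_cong_diff:
  assumes "bracket_cong g p p'" "bracket_cong g q q'"
  shows "bracket_cong g (p - q) (p' - q')"
proof -
  have "g * (p - q) - (p - q) * g - (p' - q') = (g * p - p * g - p') - (g * q - q * g - q')"
    by (simp add: algebra_simps)
  with assms show ?thesis
    by (simp only: bracket_cong_def diff_mem)
qed

lemma bracket_cong_cong:
  assumes "bracket_cong g p q" "q - q' \<in> I"
  shows "bracket_cong g p q'"
  using add_mem[OF assms[unfolded bracket_cong_def]] by (simp add: bracket_cong_def algebra_simps)

lemma bracket_cong_power:
  assumes "bracket_cong g p 0"
  shows "bracket_cong g (p ^ n) 0"
proof (induction n)
  case (Suc n)
  then show ?case using bracket_cong_mult[OF assms Suc] by simp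
qed (simp add: bracket_cong_1)

lemma bracket_cong_sum_0:
  assumes "\<And>i. i \<in> A \<Longrightarrow> bracket_cong g (p i) 0"
  shows "bracket_cong g (\<Sum>i\<in>A. p i) 0"
  using assms
proof (induction A rule: infinite_finite_induct)
  case (insert i A)
  then show ?case using bracket_cong_add[of g "p i" 0 "\<Sum>i\<in>A. p i" 0] by simp
qed (use bracket_cong_scalar[of g 0] in simp_all)

lemma bracket_cong_alg_eval:
  assumes "bracket_cong g c 0"
  shows "bracket_cong g (alg_eval p c) 0"
  unfolding alg_eval_def
  using bracket_cong_mult[OF bracket_cong_scalar bracket_cong_power[OF assms]]
  by (intro bracket_cong_sum_0) simp

end

lemma hecke_ideal_free_ideal: "free_ideal (hecke_ideal z)"
  unfolding hecke_ideal_def by (rule free_ideal_genideal)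

lemma hecke_relation_mem: "p \<in> hecke_relations z \<Longrightarrow> p \<in> hecke_ideal z"
  unfolding hecke_ideal_def using genideal_superset by blast

lemma map_free_sl2_ideal:
  assumes "p \<in> genideal free_ring sl2_relations"
  shows "map_free Inl p \<in> hecke_ideal z"
proof -
  interpret free_ideal "hecke_ideal z" by (rule hecke_ideal_free_ideal)
  have "free_ideal {p. map_free Inl p \<in> hecke_ideal z}"
    by unfold_locales
      (auto simp: map_free_add map_free_mult zero_mem add_mem mult_left_mem mult_right_mem)
  then have "genideal free_ring sl2_relations \<subseteq> {p. map_free Inl p \<in> hecke_ideal z}"
    by (rule genideal_least) (auto intro!: hecke_relation_mem simp: hecke_relations_def Let_def)
  with assms show ?thesis by auto
qed

text \<open>Twice the usual Casimir element h^2/2 + ef + fe, plus 1, which makes the eigenvalue a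
  perfect square. The factor 4 is a repeated doubling that \<open>mult_2\<close> can expand.\<close>

definition casimir :: "sl2_basis free_alg" where
  "casimir = (gen Sl2_h + 1) * (gen Sl2_h + 1) + 2 * (2 * (gen Sl2_f * gen Sl2_e))"

lemma rep_casimir:
  "rep G t (map_free Inl casimir) \<phi> = (\<lambda>a b. (of_int (a - b) + 1/2)\<^sup>2 * \<phi> a b)"
proof (intro ext)
  fix a b
  have "rep G t (map_free Inl casimir) \<phi> a b
    = ((of_int (a + b) + 1)\<^sup>2 - 4 * ((of_int a + 1 - quarter) * (of_int b + quarter))) * \<phi> a b"
    by (simp add: casimir_def map_free_add map_free_mult rep_simps)
       (simp add: power2_eq_square algebra_simps)
  also have "(of_int (a + b) + 1)\<^sup>2 - 4 * ((of_int a + 1 - quarter) * (of_int b + quarter))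
    = (of_int (a - b) + (1 - 2 * quarter))\<^sup>2"
    by (simp add: power2_eq_square algebra_simps)
  finally show "rep G t (map_free Inl casimir) \<phi> a b = (of_int (a - b) + 1/2)\<^sup>2 * \<phi> a b"
    by (simp add: quarter_def)
qed

lemma casimir_central:
  "free_ideal.bracket_cong (genideal free_ring sl2_relations) (gen g) casimir 0"
proof -
  interpret free_ideal "genideal free_ring sl2_relations :: sl2_basis free_alg set"
    by (rule free_ideal_genideal)
  let ?e = "gen Sl2_e" and ?f = "gen Sl2_f" and ?h = "gen Sl2_h"
  have rels: "?h * ?e - ?e * ?h - 2 * ?e \<in> genideal free_ring sl2_relations"
    "?h * ?f - ?f * ?h + 2 * ?f \<in> genideal free_ring sl2_relations"
    "?e * ?f - ?f * ?e - ?h \<in> genideal free_ring sl2_relations"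
    using genideal_superset[of sl2_relations]
    by (auto simp: sl2_relations_def Let_def commutator_def)
  note br = bracket_cong_add bracket_cong_mult bracket_cong_1 bracket_cong_numeral
  have self: "bracket_cong p p 0" for p
    by (simp add: bracket_cong_def zero_mem)
  show ?thesis
  proof (cases g)
    case Sl2_e
    have e: "bracket_cong ?e ?h (- 2 * ?e)" "bracket_cong ?e ?f ?h"
      using uminus_mem[OF rels(1)] rels(3) by (simp_all add: bracket_cong_def algebra_simps)
    show ?thesis
      unfolding casimir_def Sl2_e
    proof (rule bracket_cong_cong, (rule br e self)+)
      \<comment> \<open>The expression is what the Leibniz rules produce; it equals twice the
        relation [h, e] - 2e.\<close>
      show "(- 2 * ?e + 0) * (?h + 1) + (?h + 1) * (- 2 * ?e + 0)
        + (0 * (2 * (?f * ?e)) + 2 * (0 * (?f * ?e) + 2 * (?h * ?e + ?f * 0))) - 0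
        \<in> genideal free_ring sl2_relations"
        using add_mem[OF rels(1) rels(1)]
        by (simp add: algebra_simps mult_2 mult_2_right)
    qed
  next
    case Sl2_f
    have f: "bracket_cong ?f ?h (2 * ?f)" "bracket_cong ?f ?e (- ?h)"
      using uminus_mem[OF rels(2)] uminus_mem[OF rels(3)] by (simp_all add: bracket_cong_def algebra_simps)
    show ?thesis
      unfolding casimir_def Sl2_f
    proof (rule bracket_cong_cong, (rule br f self)+)
      show "(2 * ?f + 0) * (?h + 1) + (?h + 1) * (2 * ?f + 0)
        + (0 * (2 * (?f * ?e)) + 2 * (0 * (?f * ?e) + 2 * (0 * ?e + ?f * (- ?h)))) - 0
        \<in> genideal free_ring sl2_relations"
        using add_mem[OF rels(2) rels(2)]
        by (simp add: algebra_simps mult_2 mult_2_right)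
    qed
  next
    case Sl2_h
    have h: "bracket_cong ?h ?e (2 * ?e)" "bracket_cong ?h ?f (- 2 * ?f)"
      using rels(1,2) by (simp_all add: bracket_cong_def)
    show ?thesis
      unfolding casimir_def Sl2_h
    proof (rule bracket_cong_cong, (rule br h self)+)
      show "(0 + 0) * (?h + 1) + (?h + 1) * (0 + 0)
        + (0 * (2 * (?f * ?e)) + 2 * (0 * (?f * ?e) + 2 * (- 2 * ?f * ?e + ?f * (2 * ?e)))) - 0
        \<in> genideal free_ring sl2_relations"
        using zero_mem by (simp add: algebra_simps mult_2 mult_2_right)
    qed
  qed
qed

text \<open>Here \<open>z0\<close> represents z, \<open>P\<close> gives the eigenvalues of z,
  \<open>G\<close> solves the difference equation for \<open>P\<close>, and \<open>Q\<close> is the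
  corresponding sum of the two half shifts of \<open>G\<close>.\<close>

locale hecke_setup =
  fixes z :: "sl2_basis free_alg set" and z0 :: "sl2_basis free_alg" and P G Q :: "complex poly"
  assumes center: "z \<in> ring_center U_sl2"
    and z0: "z0 \<in> z"
    and rep_z: "\<And>w G t \<phi>. w \<in> z \<Longrightarrow>
      rep G t (map_free Inl w) \<phi> = (\<lambda>a b. poly P ((of_int (a - b) + 1/2)\<^sup>2) * \<phi> a b)"
    and G: "\<And>l. poly G ((l + 1/2)\<^sup>2) - poly G ((l - 1/2)\<^sup>2) = l * poly P (l\<^sup>2)"
    and Q: "\<And>l. poly G ((l + 1/2)\<^sup>2) + poly G ((l - 1/2)\<^sup>2) = poly Q (l\<^sup>2)"
begin

abbreviation "I \<equiv> hecke_ideal z"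

sublocale free_ideal I
  by (rule hecke_ideal_free_ideal)

abbreviation "e \<equiv> gen (Inl Sl2_e) :: hecke_gen free_alg"
abbreviation "f \<equiv> gen (Inl Sl2_f) :: hecke_gen free_alg"
abbreviation "h \<equiv> gen (Inl Sl2_h) :: hecke_gen free_alg"
abbreviation "x \<equiv> gen (Inr V_x) :: hecke_gen free_alg"
abbreviation "y \<equiv> gen (Inr V_y) :: hecke_gen free_alg"

text \<open>The sl2-invariant quadratic expression is f x^2 - e y^2 - h(xy + yx)/2. Writing h x y
  instead costs h z/2, which the summand h z0/2 repays. The rest, z0/2 - Q(casimir)/2, commutes with
  sl2 and adjusts the eigenvalue of T to exactly t.\<close>

definition sl2_part :: "sl2_basis free_alg" where
  "sl2_part = scalar (1/2) * ((gen Sl2_h + 1) * z0 - alg_eval Q casimir)"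

definition T :: "hecke_gen free_alg" where
  "T = f * x * x - e * y * y - h * x * y + map_free Inl sl2_part"

lemma hecke_rels:
  "bracket_cong h e (2 * e)" "bracket_cong h f (- 2 * f)" "bracket_cong e f h"
  "bracket_cong e h (- 2 * e)" "bracket_cong f h (2 * f)" "bracket_cong f e (- h)"
  "bracket_cong e x 0" "bracket_cong e y x" "bracket_cong f x y" "bracket_cong f y 0"
  "bracket_cong h x x" "bracket_cong h y (- y)"
  "bracket_cong e e 0" "bracket_cong f f 0" "bracket_cong h h 0"
  "bracket_cong x y (map_free Inl z0)"
proof -
  have "h * e - e * h - 2 * e \<in> I" "h * f - f * h + 2 * f \<in> I" "e * f - f * e - h \<in> I"
    using map_free_sl2_ideal[OF subsetD[OF genideal_superset], of _ z]
    by (force simp: sl2_relations_def Let_def commutator_def map_free_add map_free_diff map_free_mult)+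
  note sl2 = this this[THEN uminus_mem]
  have V: "e * x - x * e \<in> I" "e * y - y * e - x \<in> I" "f * x - x * f - y \<in> I" "f * y - y * f \<in> I"
    "h * x - x * h - x \<in> I" "h * y - y * h + y \<in> I" "x * y - y * x - map_free Inl z0 \<in> I"
    using z0 by (auto intro!: hecke_relation_mem simp: hecke_relations_def Let_def commutator_def)
  show "bracket_cong h e (2 * e)" "bracket_cong h f (- 2 * f)" "bracket_cong e f h"
    "bracket_cong e h (- 2 * e)" "bracket_cong f h (2 * f)" "bracket_cong f e (- h)"
    "bracket_cong e x 0" "bracket_cong e y x" "bracket_cong f x y" "bracket_cong f y 0"
    "bracket_cong h x x" "bracket_cong h y (- y)"
    "bracket_cong e e 0" "bracket_cong f f 0" "bracket_cong h h 0"
    "bracket_cong x y (map_free Inl z0)"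
    using sl2 V zero_mem by (simp_all add: bracket_cong_def algebra_simps)
qed

lemma bracket_cong_map_free:
  assumes "free_ideal.bracket_cong (genideal free_ring sl2_relations) p q r"
  shows "bracket_cong (map_free Inl p) (map_free Inl q) (map_free Inl r)"
  using map_free_sl2_ideal[of "p * q - q * p - r" z] assms
  unfolding free_ideal.bracket_cong_def[OF free_ideal_genideal] bracket_cong_def
  by (simp add: map_free_diff map_free_mult)

lemma bracket_sl2_part:
  assumes "free_ideal.bracket_cong (genideal free_ring sl2_relations) (gen g) (gen Sl2_h) r"
  shows "bracket_cong (gen (Inl g)) (map_free Inl sl2_part)
           (scalar (1/2) * (map_free Inl r * map_free Inl z0))"
proof -
  interpret J: free_ideal "genideal free_ring sl2_relations :: sl2_basis free_alg set"
    by (rule free_ideal_genideal)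
  have "J.bracket_cong (gen g) z0 0"
    using J.uminus_mem[OF U_sl2_center_commutes(1)[OF center z0, of "gen g"]]
    by (simp add: J.bracket_cong_def)
  from J.bracket_cong_mult[OF J.bracket_cong_scalar J.bracket_cong_diff[OF
      J.bracket_cong_mult[OF J.bracket_cong_add[OF assms J.bracket_cong_1] this]
      J.bracket_cong_alg_eval[OF casimir_central]], of "1/2" Q]
  have "J.bracket_cong (gen g) sl2_part (scalar (1/2) * (r * z0))"
    by (simp add: sl2_part_def)
  from bracket_cong_map_free[OF this] show ?thesis
    by (simp add: map_free_mult)
qed

lemma scalar_half_double: "scalar (1/2) * (p + p) = (p :: 'b free_alg)"
proof -
  have "scalar (1/2) * (p + p) = (scalar (1/2) + scalar (1/2)) * p"
    by (simp only: distrib_left distrib_right)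
  then show ?thesis
    by (simp flip: scalar_add)
qed

text \<open>Proved inside the ideal by the Leibniz rules, because the rewriting to normal form, on
  which faithfulness rests, already moves T past e, f and h. Commutation with x and y is deduced
  only afterwards.\<close>

lemma bracket_T: "bracket_cong (gen (Inl g)) T 0"
proof -
  interpret J: free_ideal "genideal free_ring sl2_relations :: sl2_basis free_alg set"
    by (rule free_ideal_genideal)
  have rels: "gen Sl2_h * gen Sl2_e - gen Sl2_e * gen Sl2_h - 2 * gen Sl2_e
      \<in> genideal free_ring sl2_relations"
    "gen Sl2_h * gen Sl2_f - gen Sl2_f * gen Sl2_h + 2 * gen Sl2_f \<in> genideal free_ring sl2_relations"
    using genideal_superset[of sl2_relations]
    by (auto simp: sl2_relations_def Let_def commutator_def)
  have xy: "x * y - y * x - map_free Inl z0 \<in> I"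
    using hecke_rels(16) by (simp add: bracket_cong_def)
  note br = bracket_cong_diff bracket_cong_add bracket_cong_mult
  show ?thesis
  proof (cases g)
    case Sl2_e
    have "J.bracket_cong (gen Sl2_e) (gen Sl2_h) (- 2 * gen Sl2_e)"
      using J.uminus_mem[OF rels(1)] by (simp add: J.bracket_cong_def algebra_simps)
    from bracket_sl2_part[OF this]
    have u: "bracket_cong e (map_free Inl sl2_part) (- (e * map_free Inl z0))"
      using scalar_half_double[of "- (e * map_free Inl z0)"]
      by (simp add: map_free_mult map_free_uminus map_free_diff mult_2 distrib_right left_diff_distrib)
    show ?thesis
      unfolding T_def Sl2_e
    proof (rule bracket_cong_cong, (rule br hecke_rels u)+)
      show "(h * x + f * 0) * x + f * x * 0 - ((0 * y + e * x) * y + e * y * x)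
        - ((- 2 * e * x + h * 0) * y + h * x * x) + - (e * map_free Inl z0) - 0 \<in> I"
        using mult_left_mem[OF xy, of e] by (simp add: algebra_simps mult_2)
    qed
  next
    case Sl2_f
    have "J.bracket_cong (gen Sl2_f) (gen Sl2_h) (2 * gen Sl2_f)"
      using J.uminus_mem[OF rels(2)] by (simp add: J.bracket_cong_def algebra_simps)
    from bracket_sl2_part[OF this]
    have u: "bracket_cong f (map_free Inl sl2_part) (f * map_free Inl z0)"
      using scalar_half_double[of "f * map_free Inl z0"]
      by (simp add: map_free_mult map_free_add mult_2 distrib_right)
    show ?thesis
      unfolding T_def Sl2_f
    proof (rule bracket_cong_cong, (rule br hecke_rels u)+)
      show "(0 * x + f * y) * x + f * x * y - ((- h * y + e * 0) * y + e * y * 0)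
        - ((2 * f * x + h * y) * y + h * x * 0) + f * map_free Inl z0 - 0 \<in> I"
        using uminus_mem[OF mult_left_mem[OF xy, of f]] by (simp add: algebra_simps mult_2)
    qed
  next
    case Sl2_h
    have "J.bracket_cong (gen Sl2_h) (gen Sl2_h) 0"
      using J.zero_mem by (simp add: J.bracket_cong_def)
    from bracket_sl2_part[OF this]
    have u: "bracket_cong h (map_free Inl sl2_part) 0"
      by simp
    show ?thesis
      unfolding T_def Sl2_h
    proof (rule bracket_cong_cong, (rule br hecke_rels u)+)
      show "(- 2 * f * x + f * x) * x + f * x * x - ((2 * e * y + e * - y) * y + e * y * - y)
        - ((0 * x + h * x) * y + h * x * - y) + 0 - 0 \<in> I"
        using zero_mem by (simp add: algebra_simps mult_2)
    qed
  qed
qed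

text \<open>The parts moving l by 2 cancel. The sum and the difference of the two values of t + G
  then give 2t + Q(l^2) and l P(l^2), and \<open>sl2_part\<close> removes everything but t. Doubling
  avoids halves in the ring normalisation.\<close>

lemma rep_T: "rep G t T \<phi> = (\<lambda>a b. t * \<phi> a b)"
proof (intro ext)
  fix a b
  let ?n = "a - b" and ?l = "of_int (a - b) + 1/2 :: complex"
  define l where "l = of_int (a - b) + 1 - 2 * quarter"
  have l: "l = ?l" by (simp add: l_def quarter_def)
  have nz: "l \<noteq> 0" "l + 1 \<noteq> 0" "l - 1 \<noteq> 0"
    using half_integer_nonzero[of ?n] half_integer_nonzero[of "?n + 1"]
      half_integer_nonzero[of "?n - 1"] by (simp_all add: l add_ac diff_add_eq)
  \<comment> \<open>Coefficients of the two round trips in l: \<open>q0\<close> goes down and back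
    up, \<open>q1\<close> goes up and back down.\<close>
  define q0 q1 where "q0 = raise_coeff (?n - 1) * lower_coeff G t ?n"
    and "q1 = raise_coeff ?n * lower_coeff G t (?n + 1)"
  define r0 r1 where "r0 = t + poly G ((l - 1/2)\<^sup>2)" and "r1 = t + poly G ((l + 1/2)\<^sup>2)"
  have q: "q1 = (1 / l) * (r1 / (l + 1))" "q0 = (1 / (l - 1)) * (r0 / l)"
    by (simp_all add: q0_def q1_def r0_def r1_def l raise_coeff_def lower_coeff_def add_ac diff_add_eq)
  have q': "(l + 1) * q1 = r1 / l" "(l - 1) * q0 = r0 / l"
    unfolding q using nz by simp_all
  have r: "r1 - r0 = l * poly P (l\<^sup>2)" "r1 + r0 = 2 * t + poly Q (l\<^sup>2)"
    using G[of l] Q[of l] by (simp_all add: r0_def r1_def)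
  have "2 * rep G t (f * x * x - e * y * y - h * x * y) \<phi> a b
    = ((l - 1) * ((l + 1) * q1) + (l + 1) * ((l - 1) * q0)
       - of_int (a + b) * ((l + 1) * q1 - (l - 1) * q0)) * \<phi> a b"
    by (simp add: rep_simps q0_def q1_def l_def) (simp add: algebra_simps)
  also have "\<dots> = ((r1 + r0) - (r1 - r0) / l - of_int (a + b) * ((r1 - r0) / l)) * \<phi> a b"
    unfolding q' using nz(1)
    by (simp add: add_divide_distrib diff_divide_distrib left_diff_distrib distrib_right)
  also have "\<dots> = (2 * t + poly Q (l\<^sup>2) - (of_int (a + b) + 1) * poly P (l\<^sup>2)) * \<phi> a b"
    unfolding r using nz(1) by (simp add: algebra_simps)
  finally have V: "2 * rep G t (f * x * x - e * y * y - h * x * y) \<phi> a b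
     = (2 * t + poly Q (l\<^sup>2) - (of_int (a + b) + 1) * poly P (l\<^sup>2)) * \<phi> a b" .
  have "rep G t (alg_eval Q (map_free Inl casimir)) \<phi> = (\<lambda>a b. poly Q ((of_int (a - b) + 1/2)\<^sup>2) * \<phi> a b)"
    by (rule rep_alg_eval) (rule rep_casimir)
  then have U: "rep G t (map_free Inl sl2_part) \<phi> a b
    = (1/2) * ((of_int (a + b) + 1) * poly P (l\<^sup>2) - poly Q (l\<^sup>2)) * \<phi> a b"
    by (simp add: sl2_part_def map_free_mult map_free_diff map_free_add map_free_alg_eval
        rep_simps rep_z[OF z0] l algebra_simps)
  have "2 * rep G t T \<phi> a b = 2 * (t * \<phi> a b)"
    unfolding T_def rep_add distrib_left V U by (simp add: algebra_simps)
  then show "rep G t T \<phi> a b = t * \<phi> a b" by simp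
qed

lemma rep_ideal:
  assumes "p \<in> I"
  shows "rep G t p \<phi> = (\<lambda>a b. 0)"
proof -
  have "rep G t p \<phi> = (\<lambda>a b. 0)" if "p \<in> hecke_relations z" for p \<phi>
  proof -
    from that show ?thesis
      unfolding hecke_relations_def Let_def
    proof (elim UnE)
      assume "p \<in> map_free Inl ` sl2_relations"
      then show ?thesis by (auto simp: rep_sl2_relations)
    next
      assume "p \<in> {commutator e x, commutator e y - x, commutator f x - y, commutator f y,
                commutator h x - x, commutator h y + y}"
      then show ?thesis
        using rep_bracket(4-9)[of G t \<phi>] by (elim insertE) (simp_all only: empty_iff)
    next
      assume "p \<in> {commutator x y - map_free Inl w | w. w \<in> z}"
      then obtain w where "w \<in> z" "p = commutator x y - map_free Inl w"
        by (elim CollectE exE conjE)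
      then show ?thesis by (simp add: rep_diff rep_commutator_x_y[OF G] rep_z)
    qed
  qed
  then have "genideal free_ring (hecke_relations z) \<subseteq> {p. \<forall>\<phi>. rep G t p \<phi> = (\<lambda>a b. 0)}"
    by (intro genideal_least rep_kernel_ideal) auto
  with assms show ?thesis
    unfolding hecke_ideal_def by auto
qed

end


section \<open>Spanning monomials\<close>

text \<open>
  Words are written in the letters \<open>e, f, h, x, y\<close> and an extra letter \<^term>\<open>None\<close> for the element
  \<open>T\<close>, of degree 2.  Besides sorting, the rewriting replaces \<open>f x x\<close> by \<open>T + e y y + h x y\<close> up to
  lower terms.  At this point \<open>T\<close> is only known to commute with \<open>e\<close>, \<open>f\<close> and \<open>h\<close>, which is enough
  as long as it stays to the left of all \<open>x\<close> and \<open>y\<close>.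
\<close>

type_synonym letter = "hecke_gen option"

fun rank :: "letter \<Rightarrow> nat" where
  "rank None = 0"
| "rank (Some (Inl Sl2_e)) = 1"
| "rank (Some (Inl Sl2_h)) = 2"
| "rank (Some (Inl Sl2_f)) = 3"
| "rank (Some (Inr V_x)) = 4"
| "rank (Some (Inr V_y)) = 5"

fun letter_degree :: "letter \<Rightarrow> nat" where
  "letter_degree None = 2"
| "letter_degree (Some (Inl g)) = 0"
| "letter_degree (Some (Inr v)) = 1"

definition word_degree :: "letter list \<Rightarrow> nat" where
  "word_degree w = sum_list (map letter_degree w)"

fun admissible :: "letter list \<Rightarrow> bool" where
  "admissible [] = True"
| "admissible (g # w) \<longleftrightarrow> (g \<in> range (Some \<circ> Inr) \<longrightarrow> None \<notin> set w) \<and> admissible w"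

text \<open>Earlier positions weigh more, so exchanging a descent strictly lowers the total.\<close>

fun disorder :: "letter list \<Rightarrow> nat" where
  "disorder [] = 0"
| "disorder (g # w) = Suc (length w) * rank g + disorder w"

definition x_count :: "letter list \<Rightarrow> nat" where
  "x_count w = length (filter (\<lambda>g. g = Some (Inr V_x)) w)"

lemma word_degree_simps [simp]:
  "word_degree [] = 0" "word_degree (g # w) = letter_degree g + word_degree w"
  "word_degree (u @ v) = word_degree u + word_degree v"
  "word_degree (replicate n g) = n * letter_degree g"
  by (simp_all add: word_degree_def sum_list_replicate)

lemma word_degree_sl2 [simp]: "word_degree (map (Some \<circ> Inl) w) = 0"
  by (induction w) auto

lemma x_count_simps [simp]:
  "x_count [] = 0" "x_count (g # w) = (if g = Some (Inr V_x) then 1 else 0) + x_count w"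
  "x_count (u @ v) = x_count u + x_count v"
  by (simp_all add: x_count_def)

lemma admissible_append:
  "admissible (u @ v) \<longleftrightarrow>
     admissible u \<and> admissible v \<and> (set u \<inter> range (Some \<circ> Inr) \<noteq> {} \<longrightarrow> None \<notin> set v)"
  by (induction u) auto

lemma admissible_sl2 [simp]: "admissible (map (Some \<circ> Inl) w)"
  by (induction w) auto

lemma disorder_swap:
  assumes "rank q < rank p"
  shows "disorder (u @ q # p # v) < disorder (u @ p # q # v)"
  by (induction u) (use assms in \<open>simp_all add: algebra_simps\<close>)

lemma ex_descent:
  fixes r :: "'b \<Rightarrow> nat"
  assumes "\<not> sorted (map r w)"
  shows "\<exists>u p q v. w = u @ p # q # v \<and> r q < r p"
  using assms
proof (induction w)
  case (Cons g w)
  show ?case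
  proof (cases "sorted (map r w)")
    case True
    with Cons.prems obtain g' where g': "g' \<in> set w" "r g' < r g" by auto
    then obtain q v where w: "w = q # v" by (cases w) auto
    with True g' have "r q < r g" by auto
    with w show ?thesis by (intro exI[of _ "[]"]) auto
  next
    case False
    with Cons.IH obtain u p q v where "w = u @ p # q # v" "r q < r p" by blast
    then show ?thesis by (intro exI[of _ "g # u"]) auto
  qed
qed simp

definition normal_word :: "nat \<Rightarrow> nat \<Rightarrow> nat \<Rightarrow> nat \<Rightarrow> nat \<Rightarrow> nat \<Rightarrow> letter list" where
  "normal_word k a b c i j = replicate k None @ replicate a (Some (Inl Sl2_e))
     @ replicate b (Some (Inl Sl2_h)) @ replicate c (Some (Inl Sl2_f))
     @ replicate i (Some (Inr V_x)) @ replicate j (Some (Inr V_y))"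

lemma sorted_normal_word:
  assumes "sorted (map rank w)"
  shows "\<exists>k a b c i j. w = normal_word k a b c i j"
  using assms
proof (induction w)
  case Nil
  show ?case by (simp add: normal_word_def)
next
  case (Cons g w)
  then obtain k a b c i j where w: "w = normal_word k a b c i j" by auto
  have le: "\<forall>g'\<in>set w. rank g \<le> rank g'"
    using Cons.prems by auto
  consider "g = None" | "g = Some (Inl Sl2_e)" | "g = Some (Inl Sl2_h)" | "g = Some (Inl Sl2_f)"
    | "g = Some (Inr V_x)" | "g = Some (Inr V_y)"
    by (metis rank.cases)
  then show ?case
  proof cases
    case 1
    then show ?thesis unfolding w
      by (intro exI[of _ "Suc k"] exI[of _ a] exI[of _ b] exI[of _ c] exI[of _ i] exI[of _ j])
        (simp add: normal_word_def)
  next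
    case 2
    with le have "k = 0" unfolding w by (auto simp: normal_word_def set_replicate_conv_if split: if_splits)
    with 2 show ?thesis unfolding w
      by (intro exI[of _ "0"] exI[of _ "Suc a"] exI[of _ b] exI[of _ c] exI[of _ i] exI[of _ j])
        (simp add: normal_word_def)
  next
    case 3
    with le have "k = 0" "a = 0" unfolding w by (auto simp: normal_word_def set_replicate_conv_if split: if_splits)
    with 3 show ?thesis unfolding w
      by (intro exI[of _ "0"] exI[of _ "0"] exI[of _ "Suc b"] exI[of _ c] exI[of _ i] exI[of _ j])
        (simp add: normal_word_def)
  next
    case 4
    with le have "k = 0" "a = 0" "b = 0" unfolding w by (auto simp: normal_word_def set_replicate_conv_if split: if_splits)
    with 4 show ?thesis unfolding w
      by (intro exI[of _ "0"] exI[of _ "0"] exI[of _ "0"] exI[of _ "Suc c"] exI[of _ i] exI[of _ j])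
        (simp add: normal_word_def)
  next
    case 5
    with le have "k = 0" "a = 0" "b = 0" "c = 0" unfolding w
      by (auto simp: normal_word_def set_replicate_conv_if split: if_splits)
    with 5 show ?thesis unfolding w
      by (intro exI[of _ "0"] exI[of _ "0"] exI[of _ "0"] exI[of _ "0"] exI[of _ "Suc i"] exI[of _ j])
        (simp add: normal_word_def)
  next
    case 6
    with le have "k = 0" "a = 0" "b = 0" "c = 0" "i = 0" unfolding w
      by (auto simp: normal_word_def set_replicate_conv_if split: if_splits)
    with 6 show ?thesis unfolding w
      by (intro exI[of _ "0"] exI[of _ "0"] exI[of _ "0"] exI[of _ "0"] exI[of _ "0"] exI[of _ "Suc j"])
        (simp add: normal_word_def)
  qed
qed

type_synonym exponents = "nat \<times> nat \<times> nat \<times> nat \<times> nat \<times> nat"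

text \<open>Exactly the sorted words without a factor f x x, the pattern that is rewritten by means
  of T.\<close>

definition normal_exponents :: "exponents set" where
  "normal_exponents = {(k, a, b, c, i, j). c = 0 \<or> i \<le> 1}"

fun exponents_degree :: "exponents \<Rightarrow> nat" where
  "exponents_degree (k, a, b, c, i, j) = 2 * k + i + j"

lemma single_Cons: "Poly_Mapping.single (a # w) 1 = gen a * Poly_Mapping.single w 1"
  by (simp add: gen_def mult_single_list)

lemma (in free_ideal) bracket_cong_swap:
  assumes "bracket_cong p q r"
  shows "bracket_cong q p (- r)"
  using uminus_mem[OF assms[unfolded bracket_cong_def]]
  by (simp add: bracket_cong_def algebra_simps)

section \<open>Rewriting words to normal form\<close>

context hecke_setup
begin

fun letter_value :: "letter \<Rightarrow> hecke_gen free_alg" where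
  "letter_value None = T"
| "letter_value (Some g) = gen g"

definition word_value :: "letter list \<Rightarrow> hecke_gen free_alg" where
  "word_value w = prod_list (map letter_value w)"

lemma word_value_simps [simp]:
  "word_value [] = 1" "word_value (g # w) = letter_value g * word_value w"
  "word_value (u @ v) = word_value u * word_value v"
  "word_value (replicate n g) = letter_value g ^ n"
  by (simp_all add: word_value_def prod_list_replicate)

fun monomial :: "exponents \<Rightarrow> hecke_gen free_alg" where
  "monomial (k, a, b, c, i, j) = T ^ k * e ^ a * h ^ b * f ^ c * x ^ i * y ^ j"

definition normal_span :: "nat \<Rightarrow> hecke_gen free_alg set" where
  "normal_span d =
     free_alg.span (I \<union> monomial ` {m \<in> normal_exponents. exponents_degree m \<le> d})"

lemma normal_span_mono: "d \<le> d' \<Longrightarrow> normal_span d \<subseteq> normal_span d'"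
  unfolding normal_span_def by (intro free_alg.span_mono) auto

lemma normal_span_add: "p \<in> normal_span d \<Longrightarrow> q \<in> normal_span d \<Longrightarrow> p + q \<in> normal_span d"
  and normal_span_diff: "p \<in> normal_span d \<Longrightarrow> q \<in> normal_span d \<Longrightarrow> p - q \<in> normal_span d"
  and normal_span_uminus: "p \<in> normal_span d \<Longrightarrow> - p \<in> normal_span d"
  and normal_span_scalar: "p \<in> normal_span d \<Longrightarrow> scalar c * p \<in> normal_span d"
  and normal_span_0: "0 \<in> normal_span d"
  and normal_span_ideal: "p \<in> I \<Longrightarrow> p \<in> normal_span d"
  unfolding normal_span_def
  by (auto intro: free_alg.span_add free_alg.span_diff free_alg.span_neg free_alg.span_scale
      free_alg.span_zero free_alg.span_base)

text \<open>By linearity, an arbitrary element of U(sl2) in the middle of a product reduces to words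
  in e, f, h; this treats \<open>z0\<close> and \<open>sl2_part\<close>, which are not single
  words.\<close>

lemma normal_span_sl2_insert:
  assumes "\<And>w. word_value (u @ map (Some \<circ> Inl) w @ v) \<in> normal_span d"
  shows "word_value u * map_free Inl p * word_value v \<in> normal_span d"
proof (induction p rule: free_alg_induct)
  case zero
  show ?case by (simp add: normal_span_0)
next
  case (add p q)
  then show ?case by (simp add: map_free_add distrib_left distrib_right normal_span_add)
next
  case (single w c)
  have "Poly_Mapping.single (map Inl w) 1 = word_value (map (Some \<circ> Inl) w)"
    by (induction w) (simp_all add: single_Cons flip: one_free_alg)
  then have "map_free Inl (Poly_Mapping.single w c) = scalar c * word_value (map (Some \<circ> Inl) w)"
    using mult_single_list[of "[]" c "map Inl w :: hecke_gen list" 1] by (simp add: scalar_def)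
  then have "word_value u * map_free Inl (Poly_Mapping.single w c) * word_value v
    = scalar c * word_value (u @ map (Some \<circ> Inl) w @ v)"
    by (simp add: scalar_left_commute mult.assoc)
  then show ?case
    using normal_span_scalar[OF assms] by simp
qed

text \<open>Apart from [y, x], every bracket of generators is a multiple of one generator and keeps
  the degree, so it leaves a shorter word of the same degree. For a vanishing bracket the
  coefficient is 0 and the letter only needs the right degree.\<close>

lemma bracket_letters:
  assumes "rank (Some q) < rank (Some p)" "\<not> (p = Inr V_y \<and> q = Inr V_x)"
  shows "\<exists>c g. bracket_cong (gen p) (gen q) (scalar c * gen g)
    \<and> letter_degree (Some g) = letter_degree (Some p) + letter_degree (Some q)"
proof -
  note neg = hecke_rels(7-12)[THEN bracket_cong_swap]
  have m1: "scalar (-1) * r = - r" for r :: "hecke_gen free_alg"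
    by (simp add: scalar_uminus)
  have m2: "scalar 2 * r = 2 * r" "scalar (-2) * r = - 2 * r" for r :: "hecke_gen free_alg"
    by (simp_all add: scalar_uminus scalar_numeral)
  consider "p = Inl Sl2_h" "q = Inl Sl2_e" | "p = Inl Sl2_f" "q = Inl Sl2_e"
    | "p = Inl Sl2_f" "q = Inl Sl2_h" | "p = Inr V_x" "q = Inl Sl2_e"
    | "p = Inr V_x" "q = Inl Sl2_h" | "p = Inr V_x" "q = Inl Sl2_f"
    | "p = Inr V_y" "q = Inl Sl2_e" | "p = Inr V_y" "q = Inl Sl2_h"
    | "p = Inr V_y" "q = Inl Sl2_f"
    using assms by (cases "Some p" rule: rank.cases; cases "Some q" rule: rank.cases) auto
  then show ?thesis
  proof cases
    case 1
    with hecke_rels(1) show ?thesis by (intro exI[of _ 2] exI[of _ p] exI[of _ q]) (simp add: m2)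
  next
    case 2
    with hecke_rels(6) show ?thesis
      by (intro exI[of _ "-1"] exI[of _ "Inl Sl2_h"]) (simp add: m1)
  next
    case 3
    with hecke_rels(5) show ?thesis
      by (intro exI[of _ "2"] exI[of _ "Inl Sl2_f"]) (simp add: m2)
  next
    case 4
    with neg(1) show ?thesis
      by (intro exI[of _ "0"] exI[of _ "Inr V_x"]) simp
  next
    case 5
    with neg(5) show ?thesis
      by (intro exI[of _ "-1"] exI[of _ "Inr V_x"]) (simp add: m1)
  next
    case 6
    with neg(3) show ?thesis
      by (intro exI[of _ "-1"] exI[of _ "Inr V_y"]) (simp add: m1)
  next
    case 7
    with neg(2) show ?thesis
      by (intro exI[of _ "-1"] exI[of _ "Inr V_x"]) (simp add: m1)
  next
    case 8
    with neg(6) show ?thesis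
      by (intro exI[of _ "1"] exI[of _ "Inr V_y"]) simp
  next
    case 9
    with neg(4) show ?thesis
      by (intro exI[of _ "0"] exI[of _ "Inr V_y"]) simp
  qed
qed

text \<open>Termination is lexicographic. Replacing [y, x] by z lowers the degree, every other
  bracket term shortens the word, rewriting f x x lowers the degree, the length or the number of x,
  and exchanging a descent lowers the disorder.\<close>

lemma word_value_normal_span:
  assumes "admissible w"
  shows "word_value w \<in> normal_span (word_degree w)"
  using assms
proof (induction w rule: wf_induct_rule[OF wf_measures[of "[word_degree, length, x_count, disorder]"]])
  case (1 w)
  have IH: "word_value w' \<in> normal_span (word_degree w)"
    if "(w', w) \<in> measures [word_degree, length, x_count, disorder]" "admissible w'" for w'
  proof -
    have "word_degree w' \<le> word_degree w"
      using that(1) by auto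
    then show ?thesis
      using "1.IH"[OF that] normal_span_mono by blast
  qed
  show ?case
  proof (cases "sorted (map rank w)")
    case False
    then obtain u p q v where w: "w = u @ p # q # v" and less: "rank q < rank p"
      using ex_descent by blast
    have adm: "admissible (u @ p # q # v)"
      using "1.prems" w by simp
    \<comment> \<open>Admissibility keeps T from following x or y, and the rank order keeps sl2
      letters and T from being moved past an x or y on their right; so swapping stays
      admissible.\<close>
    have pq: "(p \<in> range (Some \<circ> Inr) \<longrightarrow> q \<noteq> None) \<and> (q \<in> range (Some \<circ> Inr) \<longrightarrow> p \<in> range (Some \<circ> Inr))"
      using adm less by (cases p rule: rank.cases; cases q rule: rank.cases) (auto simp: admissible_append)
    have swap: "word_value (u @ q # p # v) \<in> normal_span (word_degree w)"
    proof (rule IH)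
      show "(u @ q # p # v, w) \<in> measures [word_degree, length, x_count, disorder]"
        using disorder_swap[OF less] by (simp add: w)
      show "admissible (u @ q # p # v)"
        using adm pq by (auto simp: admissible_append)
    qed
    have step: "word_value w \<in> normal_span (word_degree w)"
      if r: "bracket_cong (letter_value p) (letter_value q) r"
        and ur: "word_value u * r * word_value v \<in> normal_span (word_degree w)" for r
    proof -
      have "word_value w = word_value u * (letter_value p * letter_value q - letter_value q * letter_value p - r)
          * word_value v + word_value (u @ q # p # v) + word_value u * r * word_value v"
        by (simp add: w algebra_simps)
      moreover have "word_value u * (letter_value p * letter_value q - letter_value q * letter_value p - r)
          * word_value v \<in> normal_span (word_degree w)"
        using r by (intro normal_span_ideal mult_left_mem mult_right_mem) (simp add: bracket_cong_def)
      ultimately show ?thesis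
        using swap ur by (simp only: normal_span_add)
    qed
    show ?thesis
    proof (cases q)
      case None
      with pq less obtain g where "p = Some (Inl g)"
        by (cases p rule: letter_degree.cases) auto
      then have "bracket_cong (letter_value p) (letter_value q) 0"
        using bracket_T[of g] None by simp
      then show ?thesis
        by (rule step) (simp add: normal_span_0)
    next
      case (Some q')
      with less obtain p' where p': "p = Some p'" by (cases p) auto
      show ?thesis
      proof (cases "p' = Inr V_y \<and> q' = Inr V_x")
        case True
        have "bracket_cong (letter_value p) (letter_value q) (- map_free Inl z0)"
          using bracket_cong_swap[OF hecke_rels(16)] True Some p' by simp
        moreover have "word_value u * map_free Inl z0 * word_value v \<in> normal_span (word_degree w)"
          using adm True Some p'
          by (intro normal_span_sl2_insert IH) (auto simp: w admissible_append)
        ultimately show ?thesis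
          by (intro step[of "- map_free Inl z0"]) (simp_all add: normal_span_uminus)
      next
        case False
        then obtain c g where g: "bracket_cong (gen p') (gen q') (scalar c * gen g)"
          "letter_degree (Some g) = letter_degree p + letter_degree q"
          using bracket_letters less Some p' by blast
        have "g \<in> range Inr \<Longrightarrow> p \<in> range (Some \<circ> Inr)"
          using g(2) pq by (cases p rule: letter_degree.cases; cases q rule: letter_degree.cases) auto
        then have "word_value (u @ Some g # v) \<in> normal_span (word_degree w)"
          using adm by (intro IH) (use g(2) in \<open>auto simp: w admissible_append\<close>)
        then have "word_value u * (scalar c * gen g) * word_value v \<in> normal_span (word_degree w)"
          using normal_span_scalar[of _ _ c] by (simp add: scalar_left_commute mult.assoc)
        with g(1) show ?thesis
          using Some p' by (intro step) simp_all
      qed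
    qed
  next
    case True
    then obtain k a b c i j where w: "w = normal_word k a b c i j"
      using sorted_normal_word by blast
    show ?thesis
    proof (cases "c = 0 \<or> i \<le> 1")
      case True
      have wv: "word_value w = monomial (k, a, b, c, i, j)"
        by (simp add: w normal_word_def mult.assoc)
      have wd: "word_degree w = exponents_degree (k, a, b, c, i, j)"
        by (simp add: w normal_word_def)
      show ?thesis
        unfolding wv wd normal_span_def normal_exponents_def
        by (intro free_alg.span_base UnI2 imageI) (use True in simp)
    next
      case False
      then obtain c' i' where ci: "c = Suc c'" "i = Suc (Suc i')"
        by (metis Suc_le_mono bot_nat_0.extremum not0_implies_Suc One_nat_def)
      define u :: "letter list" where "u = replicate k None @ replicate a (Some (Inl Sl2_e))
        @ replicate b (Some (Inl Sl2_h)) @ replicate c' (Some (Inl Sl2_f))"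
      define v :: "letter list" where "v = replicate i' (Some (Inr V_x)) @ replicate j (Some (Inr V_y))"
      have w': "w = u @ Some (Inl Sl2_f) # Some (Inr V_x) # Some (Inr V_x) # v"
        by (simp add: w u_def v_def normal_word_def ci replicate_app_Cons_same)
      have u: "set u \<inter> range (Some \<circ> Inr) = {}"
        by (auto simp: u_def)
      have v: "None \<notin> set v"
        by (auto simp: v_def)
      have adm: "admissible u" "admissible v"
        using "1.prems" by (auto simp: w' admissible_append)
      \<comment> \<open>The definition of T solved for f x x: the T term is a shorter word, the next
        two have fewer letters x, and the last has degree smaller by 2.\<close>
      have "f * x * x = T + e * y * y + h * x * y - map_free Inl sl2_part"
        by (simp add: T_def)
      then have "word_value w = word_value u * (T + e * y * y + h * x * y - map_free Inl sl2_part) * word_value v"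
        by (simp add: w' flip: mult.assoc)
      also have "\<dots> = word_value (u @ None # v)
        + word_value (u @ Some (Inl Sl2_e) # Some (Inr V_y) # Some (Inr V_y) # v)
        + word_value (u @ Some (Inl Sl2_h) # Some (Inr V_x) # Some (Inr V_y) # v)
        - word_value u * map_free Inl sl2_part * word_value v"
        by (simp add: algebra_simps)
      also have "\<dots> \<in> normal_span (word_degree w)"
        using u v adm
        by (intro normal_span_add normal_span_diff IH normal_span_sl2_insert)
           (auto simp: w' admissible_append)
      finally show ?thesis .
    qed
  qed
qed

lemma word_normal_span:
  assumes "V_length w \<le> d"
  shows "Poly_Mapping.single w c \<in> normal_span d"
proof -
  have "Poly_Mapping.single w 1 = word_value (map Some w)"
    by (induction w) (simp_all add: single_Cons flip: one_free_alg)
  moreover have "letter_degree (Some g) = (if g \<in> range Inr then 1 else 0)" for g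
    by (cases g) auto
  then have "word_degree (map Some w) = V_length w"
    by (induction w) (auto simp: V_length_def)
  moreover have "admissible (map Some w)"
    by (induction w) auto
  ultimately have "Poly_Mapping.single w 1 \<in> normal_span d"
    using word_value_normal_span[of "map Some w"] normal_span_mono[OF assms] by auto
  then have "scalar c * Poly_Mapping.single w 1 \<in> normal_span d"
    by (rule normal_span_scalar)
  then show ?thesis
    by (simp add: scalar_def mult_single_list)
qed

lemma normal_form:
  assumes "\<forall>w\<in>Poly_Mapping.keys p. V_length w \<le> d"
  obtains A c where "finite A" "A \<subseteq> normal_exponents" "\<forall>m\<in>A. exponents_degree m \<le> d"
    "\<forall>m\<in>A. c m \<noteq> 0" "p - (\<Sum>m\<in>A. scalar (c m) * monomial m) \<in> I"
proof -
  have "p \<in> normal_span d"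
  proof -
    have "(\<Sum>w\<in>Poly_Mapping.keys p. Poly_Mapping.single w (Poly_Mapping.lookup p w)) \<in> normal_span d"
      unfolding normal_span_def
      by (rule free_alg.span_sum) (use assms word_normal_span normal_span_def in auto)
    then show ?thesis by (simp flip: free_alg_sum_monomials)
  qed
  then obtain q r where pqr: "p = q + r" "q \<in> free_alg.span I"
    "r \<in> free_alg.span (monomial ` {m \<in> normal_exponents. exponents_degree m \<le> d})"
    unfolding normal_span_def free_alg.span_Un by blast
  have "free_alg.subspace I"
    by (rule free_alg.subspaceI) (auto intro: zero_mem add_mem mult_left_mem)
  with pqr(2) have q: "q \<in> I"
    using free_alg.span_minimal[of I I] by blast
  obtain B u where B: "finite B" "B \<subseteq> monomial ` {m \<in> normal_exponents. exponents_degree m \<le> d}"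
    "r = (\<Sum>b\<in>B. scalar (u b) * b)"
    using pqr(3) unfolding free_alg.span_explicit by blast
  obtain A' where A': "A' \<subseteq> {m \<in> normal_exponents. exponents_degree m \<le> d}"
      "inj_on monomial A'" "B = monomial ` A'"
    using B(2) unfolding subset_image_inj by blast
  define A where "A = {m \<in> A'. u (monomial m) \<noteq> 0}"
  have fin: "finite A'"
    using B(1) A' finite_image_iff by blast
  have "r = (\<Sum>m\<in>A'. scalar (u (monomial m)) * monomial m)"
    unfolding B(3) A'(3) by (rule sum.reindex_cong[OF A'(2)]) auto
  also have "\<dots> = (\<Sum>m\<in>A. scalar (u (monomial m)) * monomial m)"
    unfolding A_def using fin by (intro sum.mono_neutral_right) auto
  finally have "p - (\<Sum>m\<in>A. scalar (u (monomial m)) * monomial m) \<in> I"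
    using q pqr(1) by simp
  moreover have "finite A" "A \<subseteq> normal_exponents" "\<forall>m\<in>A. exponents_degree m \<le> d"
    using fin A' by (auto simp: A_def)
  ultimately show thesis
    by (intro that[of A "\<lambda>m. u (monomial m)"]) (auto simp: A_def)
qed

end


section \<open>Independence of the monomials\<close>

lemma infinite_int_nonroots:
  assumes "p \<noteq> (0 :: complex poly)"
  shows "infinite {n :: int. poly p (of_int n) \<noteq> 0}"
proof -
  have "finite (of_int -` {z. poly p z = 0} :: int set)"
    using assms poly_roots_finite by (intro finite_vimageI) (auto intro: injI)
  then have "finite {n :: int. poly p (of_int n) = 0}"
    by (simp add: vimage_def)
  then have "infinite (- {n :: int. poly p (of_int n) = 0})"
    by (simp add: Compl_eq_Diff_UNIV Diff_infinite_finite)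
  then show ?thesis
    by (simp add: Compl_eq)
qed

text \<open>A nonzero polynomial in two variables does not vanish on all pairs of a complex number
  and an integer: first choose t where the coefficient of one power of n is nonzero, then n.\<close>

lemma bivariate_nonroot:
  fixes c :: "'m \<Rightarrow> complex" and k b :: "'m \<Rightarrow> nat"
  assumes "finite B" "inj_on (\<lambda>m. (k m, b m)) B" "m0 \<in> B" "c m0 \<noteq> 0"
  shows "\<exists>t (n :: int). (\<Sum>m\<in>B. c m * t ^ k m * of_int n ^ b m) \<noteq> 0"
proof -
  define p where "p = (\<Sum>m\<in>{m\<in>B. b m = b m0}. Polynomial.monom (c m) (k m))"
  have "poly.coeff p (k m0) = (\<Sum>m\<in>{m\<in>B. b m = b m0}. if m = m0 then c m0 else 0)"
    unfolding p_def coeff_sum coeff_monom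
    using assms(2,3) by (intro sum.cong) (auto dest: inj_onD)
  also have "\<dots> = c m0"
    using assms(1,3) by simp
  finally have "p \<noteq> 0" using assms(4) by auto
  from infinite_int_nonroots[OF this] obtain t where t: "poly p t \<noteq> 0"
    using not_finite_existsD by blast
  define q where "q = (\<Sum>m\<in>B. Polynomial.monom (c m * t ^ k m) (b m))"
  have "poly.coeff q (b m0) = (\<Sum>m\<in>B. if b m = b m0 then c m * t ^ k m else 0)"
    unfolding q_def coeff_sum coeff_monom by (intro sum.cong) auto
  also have "\<dots> = poly p t"
    using assms(1) by (simp add: p_def poly_sum poly_monom sum.If_cases Int_def)
  finally have "q \<noteq> 0" using t by auto
  from infinite_int_nonroots[OF this] obtain n :: int where "poly q (of_int n) \<noteq> 0"
    using not_finite_existsD by blast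
  then show ?thesis
    by (auto simp: q_def poly_sum poly_monom)
qed

definition delta :: "int \<Rightarrow> int \<Rightarrow> lattice_fun" where
  "delta a0 b0 = (\<lambda>a b. if a = a0 \<and> b = b0 then 1 else 0)"

text \<open>A leading term with respect to a - b: a single point on the top line and nothing above
  it. Generators raise a - b by at most 1, and only x and y raise it.\<close>

definition has_top :: "lattice_fun \<Rightarrow> int \<Rightarrow> int \<Rightarrow> complex \<Rightarrow> bool" where
  "has_top \<phi> a1 b1 c \<longleftrightarrow>
     (\<forall>a b. a - b \<ge> a1 - b1 \<longrightarrow> \<phi> a b = (if a = a1 \<and> b = b1 then c else 0))"

lemma has_top_delta: "has_top (delta a b) a b 1"
  by (simp add: has_top_def delta_def)

lemma has_top_e: "has_top \<phi> a b c \<Longrightarrow> has_top (act_gen G t (Inl Sl2_e) \<phi>) (a + 1) (b + 1) c"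
  by (auto simp: has_top_def)

lemma has_top_h:
  "has_top \<phi> a b c \<Longrightarrow> has_top (act_gen G t (Inl Sl2_h) \<phi>) a b (of_int (a + b) * c)"
  by (auto simp: has_top_def)

lemma has_top_f:
  "has_top \<phi> a b c \<Longrightarrow> has_top (act_gen G t (Inl Sl2_f) \<phi>) (a - 1) (b - 1)
     ((of_int a - quarter) * (1 - of_int b - quarter) * c)"
  by (auto simp: has_top_def algebra_simps)

lemma has_top_x:
  "has_top \<phi> a b c \<Longrightarrow> has_top (act_gen G t (Inr V_x) \<phi>) (a + 1) b (raise_coeff (a - b) * c)"
  by (auto simp: has_top_def)

lemma has_top_y:
  "has_top \<phi> a b c \<Longrightarrow> has_top (act_gen G t (Inr V_y) \<phi>) a (b - 1)
     ((1 - of_int b - quarter) * raise_coeff (a - b) * c)"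
  by (auto simp: has_top_def algebra_simps)

lemma has_top_scale: "has_top \<phi> a b c \<Longrightarrow> has_top (\<lambda>a b. s * \<phi> a b) a b (s * c)"
  by (simp add: has_top_def)

lemma has_top_e_power:
  "has_top \<phi> a b c \<Longrightarrow> has_top (rep G t (gen (Inl Sl2_e) ^ n) \<phi>) (a + int n) (b + int n) c"
proof (induction n)
  case (Suc n)
  from has_top_e[OF Suc.IH[OF Suc.prems], of G t] show ?case
    by (simp add: rep_mult algebra_simps)
qed simp

lemma has_top_h_power:
  "has_top \<phi> a b c \<Longrightarrow> has_top (rep G t (gen (Inl Sl2_h) ^ n) \<phi>) a b (of_int (a + b) ^ n * c)"
proof (induction n)
  case (Suc n)
  from has_top_h[OF Suc.IH[OF Suc.prems], of G t] show ?case
    by (simp add: rep_mult mult.assoc)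
qed simp

lemma has_top_f_power:
  "has_top \<phi> a b c \<Longrightarrow> has_top (rep G t (gen (Inl Sl2_f) ^ n) \<phi>) (a - int n) (b - int n)
     ((\<Prod>s<n. (of_int a - of_nat s - quarter) * (1 - of_int b + of_nat s - quarter)) * c)"
proof (induction n)
  case (Suc n)
  from has_top_f[OF Suc.IH[OF Suc.prems], of G t] show ?case
    by (simp add: rep_mult algebra_simps)
qed simp

lemma has_top_x_power:
  "has_top \<phi> a b c \<Longrightarrow> has_top (rep G t (gen (Inr V_x) ^ n) \<phi>) (a + int n) b
     ((\<Prod>s<n. raise_coeff (a - b + int s)) * c)"
proof (induction n)
  case (Suc n)
  from has_top_x[OF Suc.IH[OF Suc.prems], of G t] show ?case
    by (simp add: rep_mult algebra_simps)
qed simp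

lemma has_top_y_power:
  "has_top \<phi> a b c \<Longrightarrow> has_top (rep G t (gen (Inr V_y) ^ n) \<phi>) a (b - int n)
     ((\<Prod>s<n. 1 - of_int b + of_nat s - quarter) * (\<Prod>s<n. raise_coeff (a - b + int s)) * c)"
proof (induction n)
  case (Suc n)
  from has_top_y[OF Suc.IH[OF Suc.prems], of G t] show ?case
    by (simp add: rep_mult algebra_simps)
qed simp

abbreviation "T_exp m \<equiv> fst m"
abbreviation "e_exp m \<equiv> fst (snd m)"
abbreviation "h_exp m \<equiv> fst (snd (snd m))"
abbreviation "f_exp m \<equiv> fst (snd (snd (snd m)))"
abbreviation "x_exp m \<equiv> fst (snd (snd (snd (snd m))))"
abbreviation "y_exp m \<equiv> snd (snd (snd (snd (snd m))))"

text \<open>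
  The part of the top coefficient of a monomial that varies with \<open>a\<close> on the line \<open>a + b = \<mu>\<close>.
  Since it is monic of degree \<open>j + 2 c\<close>, and \<open>c = 0\<close> or \<open>j \<ge> d - 1\<close>, its degree determines
  \<open>j\<close> and \<open>c\<close> once \<open>d = i + j\<close> is known.
\<close>

definition top_poly :: "int \<Rightarrow> exponents \<Rightarrow> complex poly" where
  "top_poly \<mu> m =
     (\<Prod>s<f_exp m. [:of_nat (x_exp m) - of_nat s - quarter, 1:]
                   * [:1 - of_int \<mu> + of_nat (y_exp m) + of_nat s - quarter, 1:])
     * (\<Prod>s<y_exp m. [:1 - of_int \<mu> + of_nat s - quarter, 1:])"

lemma degree_top_poly: "Polynomial.degree (top_poly \<mu> m) = y_exp m + 2 * f_exp m"
proof -
  have quadratic: "Polynomial.degree (\<Prod>s<n. [:u s, 1:] * [:v s, 1 :: complex:]) = 2 * n"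
    "(\<Prod>s<n. [:u s, 1:] * [:v s, 1 :: complex:]) \<noteq> 0" for u v and n :: nat
    by (subst degree_prod_eq_sum_degree) (auto simp: degree_mult_eq)
  have linear: "Polynomial.degree (\<Prod>s<n. [:u s, 1 :: complex:]) = n"
    "(\<Prod>s<n. [:u s, 1 :: complex:]) \<noteq> 0" for u and n :: nat
    by (subst degree_prod_eq_sum_degree) auto
  show ?thesis
    unfolding top_poly_def degree_mult_eq[OF quadratic(2) linear(2)] quadratic(1) linear(1) by simp
qed

text \<open>If both i are at most 1, the two j differ by at most 1 while their difference is even.
  If c = 0 < c', then j = j' + 2c' would be at least d + 1.\<close>

lemma top_exponents_unique:
  fixes c c' i i' j j' d :: nat
  assumes "c = 0 \<or> i \<le> 1" "c' = 0 \<or> i' \<le> 1" "i + j = d" "i' + j' = d" "j + 2 * c = j' + 2 * c'"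
  shows "c = c'"
  using assms by (elim disjE) linarith+

lemma raise_coeff_nonzero: "raise_coeff n \<noteq> 0"
  using half_integer_nonzero by (simp add: raise_coeff_def)

context hecke_setup
begin

lemma monomial_eq:
  "monomial m = T ^ T_exp m * e ^ e_exp m * h ^ h_exp m * f ^ f_exp m * x ^ x_exp m * y ^ y_exp m"
  by (cases m) simp

lemma rep_T_power: "rep G t (T ^ n) \<phi> = (\<lambda>a b. t ^ n * \<phi> a b)"
  by (induction n) (simp_all add: rep_mult rep_T mult.assoc)

text \<open>The coefficient separates the exponents: t sees T, the weight sees h, and the polynomial
  in a sees f and y. The product of raising coefficients depends only on i + j and is therefore
  common to all monomials of the same top degree.\<close>

lemma has_top_monomial:
  "has_top (rep G t (monomial m) (delta a (\<mu> - a)))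
     (a + int (e_exp m) + int (x_exp m) - int (f_exp m))
     (\<mu> - a + int (e_exp m) - int (f_exp m) - int (y_exp m))
     (t ^ T_exp m * of_int (\<mu> + int (x_exp m) - int (y_exp m) - 2 * int (f_exp m)) ^ h_exp m
       * poly (top_poly \<mu> m) (of_int a)
       * (\<Prod>s<x_exp m + y_exp m. raise_coeff (2 * a - \<mu> + int s)))"
proof -
  let ?i = "x_exp m" and ?j = "y_exp m" and ?c = "f_exp m"
  have top: "has_top (rep G t (monomial m) (delta a (\<mu> - a)))
     (a + int ?i - int ?c + int (e_exp m)) (\<mu> - a - int ?j - int ?c + int (e_exp m))
     (t ^ T_exp m * (of_int (a + int ?i - int ?c + (\<mu> - a - int ?j - int ?c)) ^ h_exp m
       * ((\<Prod>s<?c. (of_int (a + int ?i) - of_nat s - quarter)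
            * (1 - of_int (\<mu> - a - int ?j) + of_nat s - quarter))
         * ((\<Prod>s<?i. raise_coeff (a - (\<mu> - a - int ?j) + int s))
           * ((\<Prod>s<?j. 1 - of_int (\<mu> - a) + of_nat s - quarter)
              * (\<Prod>s<?j. raise_coeff (a - (\<mu> - a) + int s)) * 1)))))"
    unfolding monomial_eq rep_mult rep_T_power
    by (intro has_top_scale has_top_e_power has_top_h_power has_top_f_power has_top_x_power
        has_top_y_power has_top_delta)
  have raise: "(\<Prod>s<?i. raise_coeff (a - (\<mu> - a - int ?j) + int s))
      * (\<Prod>s<?j. raise_coeff (a - (\<mu> - a) + int s))
      = (\<Prod>s<?i + ?j. raise_coeff (2 * a - \<mu> + int s))"
  proof -
    have "(\<Prod>s<?j + ?i. raise_coeff (2 * a - \<mu> + int s))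
      = (\<Prod>s<?j. raise_coeff (2 * a - \<mu> + int s)) * (\<Prod>s<?i. raise_coeff (2 * a - \<mu> + int (?j + s)))"
    proof -
      have "(\<Prod>s<?j + n. g s) = (\<Prod>s<?j. g s) * (\<Prod>s<n. g (?j + s))" for g :: "nat \<Rightarrow> complex" and n
        by (induction n) (simp_all add: mult.assoc)
      then show ?thesis .
    qed
    then show ?thesis by (simp add: algebra_simps)
  qed
  have tp: "poly (top_poly \<mu> m) (of_int a)
    = (\<Prod>s<?c. (of_int (a + int ?i) - of_nat s - quarter)
            * (1 - of_int (\<mu> - a - int ?j) + of_nat s - quarter))
      * (\<Prod>s<?j. 1 - of_int (\<mu> - a) + of_nat s - quarter)"
    by (simp add: top_poly_def poly_prod algebra_simps)
  have "t ^ T_exp m * (of_int (a + int ?i - int ?c + (\<mu> - a - int ?j - int ?c)) ^ h_exp m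
       * ((\<Prod>s<?c. (of_int (a + int ?i) - of_nat s - quarter)
            * (1 - of_int (\<mu> - a - int ?j) + of_nat s - quarter))
         * ((\<Prod>s<?i. raise_coeff (a - (\<mu> - a - int ?j) + int s))
           * ((\<Prod>s<?j. 1 - of_int (\<mu> - a) + of_nat s - quarter)
              * (\<Prod>s<?j. raise_coeff (a - (\<mu> - a) + int s)) * 1))))
    = t ^ T_exp m * of_int (\<mu> + int ?i - int ?j - 2 * int ?c) ^ h_exp m
       * poly (top_poly \<mu> m) (of_int a)
       * (\<Prod>s<?i + ?j. raise_coeff (2 * a - \<mu> + int s))"
    unfolding raise[symmetric] tp by (simp add: mult_ac algebra_simps)
  with top show ?thesis
    by (simp only: algebra_simps)
qed

text \<open>Among the monomials whose leading points agree, those of maximal degree in a share all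
  exponents except those of T and h; \<open>bivariate_nonroot\<close> then supplies t and a weight
  at which their sum survives. The entry is thus a nonzero polynomial in a times nonzero factors.
  Nonvanishing for infinitely many a, not just one, is what the determination of the center
  needs.\<close>

lemma monomials_independent:
  assumes A: "finite A" "A \<subseteq> normal_exponents" "\<forall>m\<in>A. c m \<noteq> 0"
    and d: "\<forall>m\<in>A. x_exp m + y_exp m \<le> d" and m1: "m1 \<in> A" "x_exp m1 + y_exp m1 = d"
  obtains t p q \<mu> where "p - q = int d"
    "infinite {a. rep G t (\<Sum>m\<in>A. scalar (c m) * monomial m) (delta a (\<mu> - a)) (a + p) (\<mu> - a + q) \<noteq> 0}"
proof -
  define p where "p = int (e_exp m1) + int (x_exp m1) - int (f_exp m1)"
  define q where "q = int (e_exp m1) - int (f_exp m1) - int (y_exp m1)"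
  have pq: "p - q = int d"
    by (simp add: p_def q_def flip: m1(2))
  \<comment> \<open>The monomials of top degree d whose leading point is that of \<open>m1\<close>;
    d and the displacement of the first coordinate fix that of the second.\<close>
  define B where "B = {m \<in> A. x_exp m + y_exp m = d \<and> int (e_exp m) + int (x_exp m) - int (f_exp m) = p}"
  have B: "finite B" "m1 \<in> B" "B \<subseteq> A"
    using A(1) m1 by (auto simp: B_def p_def)
  define deg where "deg m = y_exp m + 2 * f_exp m" for m :: exponents
  define D where "D = Max (deg ` B)"
  have D: "deg m \<le> D" if "m \<in> B" for m
    using B(1) that by (simp add: D_def)
  have "D \<in> deg ` B"
    unfolding D_def using B by (intro Max_in) auto
  then obtain m0 where m0: "m0 \<in> B" "deg m0 = D" by auto
  define B' where "B' = {m \<in> B. deg m = D}"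
  have B': "finite B'" "m0 \<in> B'"
    using B m0 by (auto simp: B'_def)
  have same: "y_exp m = y_exp m0 \<and> f_exp m = f_exp m0 \<and> x_exp m = x_exp m0 \<and> e_exp m = e_exp m0"
    if "m \<in> B'" for m
  proof -
    have nf: "f_exp m = 0 \<or> x_exp m \<le> 1" "f_exp m0 = 0 \<or> x_exp m0 \<le> 1"
      using A(2) B(3) that m0(1) by (auto simp: normal_exponents_def B'_def)
    have eq: "x_exp m + y_exp m = d" "x_exp m0 + y_exp m0 = d"
        "y_exp m + 2 * f_exp m = y_exp m0 + 2 * f_exp m0"
        "int (e_exp m) + int (x_exp m) - int (f_exp m) = int (e_exp m0) + int (x_exp m0) - int (f_exp m0)"
      using that m0 by (auto simp: B'_def B_def deg_def)
    from nf eq(1-3) have "f_exp m = f_exp m0"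
      by (rule top_exponents_unique)
    with eq show ?thesis by simp
  qed
  have "inj_on (\<lambda>m. (T_exp m, h_exp m)) B'"
    by (rule inj_onI) (auto simp: prod_eq_iff dest!: same)
  then obtain t and \<nu> :: int where t\<nu>: "(\<Sum>m\<in>B'. c m * t ^ T_exp m * of_int \<nu> ^ h_exp m) \<noteq> 0"
    using bivariate_nonroot[OF B'(1) _ B'(2), where k = T_exp and b = h_exp and c = c] A(3) B(3) m0(1) by blast
  \<comment> \<open>The starting weight, chosen so that the weight is \<open>\<nu>\<close> when h
    acts, after y, x and f have been applied.\<close>
  define \<mu> where "\<mu> = \<nu> - (int (x_exp m0) - int (y_exp m0) - 2 * int (f_exp m0))"
  define w where "w m = c m * t ^ T_exp m
      * of_int (\<mu> + int (x_exp m) - int (y_exp m) - 2 * int (f_exp m)) ^ h_exp m" for m :: exponents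
  define R where "R = (\<Sum>m\<in>B. Polynomial.smult (w m) (top_poly \<mu> m))"
  have monic: "poly.coeff (top_poly \<mu> m) (deg m) = 1" for m
  proof -
    have "lead_coeff (top_poly \<mu> m) = 1"
      by (simp add: top_poly_def lead_coeff_mult lead_coeff_prod)
    then show ?thesis
      by (simp add: degree_top_poly deg_def)
  qed
  have "poly.coeff R D = (\<Sum>m\<in>B. if deg m = D then w m else 0)"
    unfolding R_def coeff_sum coeff_smult
  proof (rule sum.cong)
    fix m assume "m \<in> B"
    show "w m * poly.coeff (top_poly \<mu> m) D = (if deg m = D then w m else 0)"
    proof (cases "deg m = D")
      case True
      then show ?thesis using monic[of m] by simp
    next
      case False
      with D[OF \<open>m \<in> B\<close>] have "Polynomial.degree (top_poly \<mu> m) < D"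
        by (simp add: degree_top_poly deg_def)
      with False show ?thesis by (simp add: coeff_eq_0)
    qed
  qed simp
  also have "\<dots> = (\<Sum>m\<in>B'. w m)"
    using B(1) by (simp add: B'_def sum.If_cases Int_def)
  also have "\<dots> = (\<Sum>m\<in>B'. c m * t ^ T_exp m * of_int \<nu> ^ h_exp m)"
    by (rule sum.cong) (use same in \<open>auto simp: w_def \<mu>_def\<close>)
  finally have "R \<noteq> 0"
    using t\<nu> by auto
  have entry: "rep G t (\<Sum>m\<in>A. scalar (c m) * monomial m) (delta a (\<mu> - a)) (a + p) (\<mu> - a + q)
    = poly R (of_int a) * (\<Prod>s<d. raise_coeff (2 * a - \<mu> + int s))" for a
  proof -
    have "rep G t (monomial m) (delta a (\<mu> - a)) (a + p) (\<mu> - a + q)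
      = (if m \<in> B then t ^ T_exp m * of_int (\<mu> + int (x_exp m) - int (y_exp m) - 2 * int (f_exp m)) ^ h_exp m
          * poly (top_poly \<mu> m) (of_int a) * (\<Prod>s<d. raise_coeff (2 * a - \<mu> + int s)) else 0)"
      if "m \<in> A" for m
    proof -
      \<comment> \<open>The chosen point lies on or above the top line of every monomial of A, so
        monomials outside B contribute 0 there.\<close>
      have ge: "(a + p) - (\<mu> - a + q)
        \<ge> (a + int (e_exp m) + int (x_exp m) - int (f_exp m))
          - (\<mu> - a + int (e_exp m) - int (f_exp m) - int (y_exp m))"
        using bspec[OF d that] pq by linarith
      have iff: "(a + p = a + int (e_exp m) + int (x_exp m) - int (f_exp m)
           \<and> \<mu> - a + q = \<mu> - a + int (e_exp m) - int (f_exp m) - int (y_exp m)) \<longleftrightarrow> m \<in> B"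
        using that pq by (auto simp: B_def)
      show ?thesis
        using has_top_monomial[of t m a \<mu>, unfolded has_top_def, rule_format, OF ge]
        unfolding iff by (auto simp: B_def)
    qed
    then have "rep G t (\<Sum>m\<in>A. scalar (c m) * monomial m) (delta a (\<mu> - a)) (a + p) (\<mu> - a + q)
      = (\<Sum>m\<in>A. if m \<in> B then w m * poly (top_poly \<mu> m) (of_int a)
          * (\<Prod>s<d. raise_coeff (2 * a - \<mu> + int s)) else 0)"
      unfolding rep_sum rep_mult rep_scalar by (intro sum.cong) (auto simp: w_def)
    also have "\<dots> = (\<Sum>m\<in>B. w m * poly (top_poly \<mu> m) (of_int a)
          * (\<Prod>s<d. raise_coeff (2 * a - \<mu> + int s)))"
      using A(1) B(3) by (simp add: sum.If_cases Int_absorb1)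
    finally show ?thesis
      by (simp add: R_def poly_sum sum_distrib_right)
  qed
  show thesis
  proof (rule that[OF pq])
    show "infinite {a. rep G t (\<Sum>m\<in>A. scalar (c m) * monomial m) (delta a (\<mu> - a)) (a + p) (\<mu> - a + q) \<noteq> 0}"
      using infinite_int_nonroots[OF \<open>R \<noteq> 0\<close>] raise_coeff_nonzero by (simp add: entry)
  qed
qed

end


section \<open>The center\<close>

lemma rep_sl2_independent: "rep G t (map_free Inl q) \<phi> = rep G' t' (map_free Inl q) \<phi>"
proof -
  obtain S F where "\<forall>G t \<phi> a b. rep G t (map_free Inl q) \<phi> a b
       = (\<Sum>s\<in>S. eval_lattice (F s) a b * \<phi> (a - s) (b - s))"
    using rep_sl2[of q] by (elim exE conjE)
  then show ?thesis by (simp add: fun_eq_iff)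
qed

lemma rep_sl2_support:
  assumes "a' - b' \<noteq> a - b"
  shows "rep G t (map_free Inl q) (delta a b) a' b' = 0"
proof -
  obtain S F where "\<forall>G t \<phi> a b. rep G t (map_free Inl q) \<phi> a b
       = (\<Sum>s\<in>S. eval_lattice (F s) a b * \<phi> (a - s) (b - s))"
    using rep_sl2[of q] by (elim exE conjE)
  moreover have "delta a b (a' - s) (b' - s) = 0" for s
    using assms by (auto simp: delta_def)
  ultimately show ?thesis by simp
qed

lemma int_shift_invariant:
  fixes v :: "int \<Rightarrow> 'b"
  assumes "\<And>a. v (a + 1) = v a"
  shows "v a = v 0"
proof (induction a rule: int_induct[of _ 0])
  case (step1 i)
  then show ?case using assms by simp
next
  case (step2 i)
  then show ?case using assms[of "i - 1"] by simp
qed simp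

lemma keys_map_free: "Poly_Mapping.keys (map_free f p) \<subseteq> map f ` Poly_Mapping.keys p"
proof -
  have "Poly_Mapping.keys (map_free f p) \<subseteq>
    (\<Union>w\<in>Poly_Mapping.keys p. Poly_Mapping.keys (Poly_Mapping.single (map f w) (Poly_Mapping.lookup p w)))"
    unfolding map_free_def by (rule keys_sum)
  also have "\<dots> \<subseteq> map f ` Poly_Mapping.keys p"
    by (auto split: if_splits)
  finally show ?thesis .
qed

section \<open>Coefficient functions of \<open>UP\<close> as polynomials\<close>

definition poly_of_UP :: "(nat \<Rightarrow> complex) \<Rightarrow> complex poly" where
  "poly_of_UP p = (\<Sum>i\<le>deg ring_of_type_algebra p. Polynomial.monom (p i) i)"

lemma complex_ring_simps [simp]:
  "carrier (ring_of_type_algebra :: complex ring) = UNIV"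
  "a \<oplus>\<^bsub>ring_of_type_algebra\<^esub> b = a + b" "a \<otimes>\<^bsub>ring_of_type_algebra\<^esub> b = a * b"
  "\<one>\<^bsub>ring_of_type_algebra\<^esub> = (1 :: complex)" "\<zero>\<^bsub>ring_of_type_algebra\<^esub> = (0 :: complex)"
  for a b :: complex
  by (simp_all add: ring_of_type_algebra_def)

lemma coeff_UP:
  assumes "p \<in> carrier (UP R)"
  shows "UnivPoly.coeff (UP R) p = p"
  using assms by (simp add: UP_def)

lemma above_deg_eq_0:
  assumes "p \<in> carrier (UP (ring_of_type_algebra :: complex ring))"
    and "deg (ring_of_type_algebra :: complex ring) p < j"
  shows "p j = 0"
proof -
  interpret UP_cring "ring_of_type_algebra :: complex ring" "UP (ring_of_type_algebra :: complex ring)"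
    by (intro UP_cring.intro cring_from_type_algebra)
  show ?thesis
    using deg_aboveD[OF assms(2,1)] unfolding coeff_UP[OF assms(1)] complex_ring_simps .
qed

lemma coeff_poly_of_UP:
  assumes "p \<in> carrier (UP (ring_of_type_algebra :: complex ring))"
  shows "poly.coeff (poly_of_UP p) j = p j"
  using above_deg_eq_0[OF assms, of j] by (auto simp: poly_of_UP_def coeff_sum coeff_monom)

context hecke_setup
begin

lemma ex_normal_form:
  obtains A c where "finite A" "A \<subseteq> normal_exponents" "\<forall>m\<in>A. c m \<noteq> 0"
    "p - (\<Sum>m\<in>A. scalar (c m) * monomial m) \<in> I"
proof -
  have "\<forall>w\<in>Poly_Mapping.keys p. V_length w \<le> Max (insert 0 (V_length ` Poly_Mapping.keys p))"
    by simp
  then obtain A c where "finite A" "A \<subseteq> normal_exponents" "\<forall>m\<in>A. c m \<noteq> 0"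
    "p - (\<Sum>m\<in>A. scalar (c m) * monomial m) \<in> I"
    by (rule normal_form)
  then show thesis
    by (rule that)
qed

lemma monomials_independent_Max:
  assumes A: "finite A" "A \<subseteq> normal_exponents" "\<forall>m\<in>A. c m \<noteq> 0" and "A \<noteq> {}"
  obtains t p q \<mu> where "p - q = int (Max ((\<lambda>m. x_exp m + y_exp m) ` A))"
    "infinite {a. rep G t (\<Sum>m\<in>A. scalar (c m) * monomial m) (delta a (\<mu> - a)) (a + p) (\<mu> - a + q) \<noteq> 0}"
proof -
  let ?d = "Max ((\<lambda>m. x_exp m + y_exp m) ` A)"
  have "?d \<in> (\<lambda>m. x_exp m + y_exp m) ` A"
    using A(1) \<open>A \<noteq> {}\<close> by (intro Max_in) auto
  then obtain m1 where m1: "m1 \<in> A" "x_exp m1 + y_exp m1 = ?d" by auto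
  have le: "\<forall>m\<in>A. x_exp m + y_exp m \<le> ?d"
    using A(1) by simp
  show thesis
    by (rule monomials_independent[where c = c, OF A le m1]) (rule that)
qed

lemma monomials_independent_rep:
  assumes A: "finite A" "A \<subseteq> normal_exponents" "\<forall>m\<in>A. c m \<noteq> 0"
    and zero: "\<And>t a b. rep G t (\<Sum>m\<in>A. scalar (c m) * monomial m) (delta a b) = (\<lambda>_ _. 0)"
  shows "A = {}"
proof (rule ccontr)
  assume "A \<noteq> {}"
  then obtain t p q \<mu> where
    "infinite {a. rep G t (\<Sum>m\<in>A. scalar (c m) * monomial m) (delta a (\<mu> - a)) (a + p) (\<mu> - a + q) \<noteq> 0}"
    by (rule monomials_independent_Max[where c = c, OF A])
  with zero show False by simp
qed

text \<open>Joint faithfulness of the family: the normal form of p acts as p does, so if p acts by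
  zero no monomial can occur in it. From here on, congruences modulo the ideal are checked on basis
  vectors.\<close>

lemma rep_delta_faithful:
  assumes "\<And>t a b. rep G t p (delta a b) = (\<lambda>_ _. 0)"
  shows "p \<in> I"
proof -
  obtain A c where A: "finite A" "A \<subseteq> normal_exponents" "\<forall>m\<in>A. c m \<noteq> 0"
    and diff: "p - (\<Sum>m\<in>A. scalar (c m) * monomial m) \<in> I"
    by (rule ex_normal_form)
  have "A = {}"
  proof (rule monomials_independent_rep[where c = c, OF A])
    show "rep G t (\<Sum>m\<in>A. scalar (c m) * monomial m) (delta a b) = (\<lambda>_ _. 0)" for t a b
      using rep_ideal[OF diff, of t "delta a b"] assms by (simp add: rep_diff fun_eq_iff)
  qed
  with diff show ?thesis by simp
qed

lemma rep_alg_eval_T: "rep G t (alg_eval g T) \<phi> = (\<lambda>a b. poly g t * \<phi> a b)"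
  by (rule rep_alg_eval) (rule rep_T)

lemma congruent_if_rep_scalar:
  assumes "\<And>t \<phi>. rep G t p \<phi> = (\<lambda>a b. u t * \<phi> a b)" "\<And>t \<phi>. rep G t q \<phi> = (\<lambda>a b. u t * \<phi> a b)"
  shows "p - q \<in> I"
  by (rule rep_delta_faithful) (simp add: rep_diff assms)

lemma alg_eval_T_central: "alg_eval g T * q - q * alg_eval g T \<in> I"
  by (rule rep_delta_faithful) (simp add: rep_diff rep_mult rep_alg_eval_T rep_fun_scale)

text \<open>Compare the Casimir eigenvalues before and after the leading part of p, which raises l
  by d. Their difference d(2l + d) vanishes for at most one a when d > 0, against infinitely many
  nonzero entries.\<close>

lemma central_imp_degree_0:
  assumes comm: "\<And>q. p * q - q * p \<in> I"
    and A: "finite A" "A \<subseteq> normal_exponents" "\<forall>m\<in>A. c m \<noteq> 0"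
    and diff: "p - (\<Sum>m\<in>A. scalar (c m) * monomial m) \<in> I"
    and m: "m \<in> A"
  shows "x_exp m + y_exp m = 0"
proof -
  define S where "S = (\<Sum>m\<in>A. scalar (c m) * monomial m)"
  have rep_S: "rep G t S \<phi> = rep G t p \<phi>" for t \<phi>
    using rep_ideal[OF diff, of t \<phi>] by (simp add: rep_diff S_def fun_eq_iff)
  define d where "d = Max ((\<lambda>m. x_exp m + y_exp m) ` A)"
  have le: "x_exp m + y_exp m \<le> d"
    using A(1) m by (simp add: d_def)
  have "A \<noteq> {}" using m by auto
  then obtain t p' q \<mu> where pq: "p' - q = int d" and
    inf: "infinite {a. rep G t S (delta a (\<mu> - a)) (a + p') (\<mu> - a + q) \<noteq> 0}"
    unfolding S_def d_def by (rule monomials_independent_Max[where c = c, OF A])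
  have "d = 0"
  proof (rule ccontr)
    assume "d \<noteq> 0"
    have "rep G t S (delta a (\<mu> - a)) (a + p') (\<mu> - a + q) = 0" if "2 * (2 * a - \<mu>) + 1 + int d \<noteq> 0" for a
    proof -
      let ?l = "of_int (2 * a - \<mu>) + 1/2 :: complex"
      let ?C = "map_free Inl casimir"
      have "rep G t ?C (delta a (\<mu> - a)) = (\<lambda>a' b'. ?l\<^sup>2 * delta a (\<mu> - a) a' b')"
        by (auto simp: rep_casimir delta_def fun_eq_iff)
      then have "rep G t p (rep G t ?C (delta a (\<mu> - a))) (a + p') (\<mu> - a + q)
        = ?l\<^sup>2 * rep G t p (delta a (\<mu> - a)) (a + p') (\<mu> - a + q)"
        by (simp only: rep_fun_scale)
      moreover have "rep G t ?C (rep G t p (delta a (\<mu> - a))) (a + p') (\<mu> - a + q)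
        = (?l + of_nat d)\<^sup>2 * rep G t p (delta a (\<mu> - a)) (a + p') (\<mu> - a + q)"
      proof -
        have shift: "a + p' - (\<mu> - a + q) = 2 * a - \<mu> + int d"
          using pq by simp
        show ?thesis
          unfolding rep_casimir shift by (simp only: of_int_add of_int_of_nat_eq add_ac)
      qed
      moreover have "rep G t p (rep G t ?C (delta a (\<mu> - a))) = rep G t ?C (rep G t p (delta a (\<mu> - a)))"
        using rep_ideal[OF comm[of ?C], of t "delta a (\<mu> - a)"] by (simp add: rep_diff rep_mult fun_eq_iff)
      ultimately have "((?l + of_nat d)\<^sup>2 - ?l\<^sup>2) * rep G t S (delta a (\<mu> - a)) (a + p') (\<mu> - a + q) = 0"
        by (simp add: rep_S left_diff_distrib)
      moreover have "(?l + of_nat d)\<^sup>2 - ?l\<^sup>2 = of_nat d * of_int (2 * (2 * a - \<mu>) + 1 + int d)"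
        by (simp add: power2_eq_square algebra_simps)
      ultimately show ?thesis
        using that \<open>d \<noteq> 0\<close> by (simp only: mult_eq_0_iff of_nat_eq_0_iff of_int_eq_0_iff simp_thms)
    qed
    moreover have "a = (2 * \<mu> - 1 - int d) div 4" if "2 * (2 * a - \<mu>) + 1 + int d = 0" for a
    proof -
      from that have "2 * \<mu> - 1 - int d = 4 * a" by (simp add: algebra_simps)
      then show ?thesis by simp
    qed
    ultimately have "{a. rep G t S (delta a (\<mu> - a)) (a + p') (\<mu> - a + q) \<noteq> 0} \<subseteq> {(2 * \<mu> - 1 - int d) div 4}"
      by blast
    with inf show False
      using finite_subset by blast
  qed
  with le show ?thesis by simp
qed

text \<open>Elements T^k u with u in U(sl2) preserve l, so commuting with h makes p diagonal; e and
  x then connect all lattice points and force one eigenvalue, and faithfulness turns this into a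
  congruence.\<close>

lemma central_imp_alg_eval_T:
  assumes comm: "\<And>q. p * q - q * p \<in> I"
  obtains g where "p - alg_eval g T \<in> I"
proof -
  obtain A c where A: "finite A" "A \<subseteq> normal_exponents" "\<forall>m\<in>A. c m \<noteq> 0"
    and diff: "p - (\<Sum>m\<in>A. scalar (c m) * monomial m) \<in> I"
    by (rule ex_normal_form)
  note degree0 = central_imp_degree_0[OF comm A diff]
  define sl2_mon where "sl2_mon m = gen Sl2_e ^ e_exp m * gen Sl2_h ^ h_exp m * gen Sl2_f ^ f_exp m" for m :: exponents
  have mon: "rep G t (monomial m) \<phi> = (\<lambda>a b. t ^ T_exp m * rep 0 0 (map_free Inl (sl2_mon m)) \<phi> a b)"
    if "m \<in> A" for m t \<phi>
  proof -
    have "monomial m = T ^ T_exp m * map_free Inl (sl2_mon m)"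
      using degree0[OF that] by (simp add: monomial_eq sl2_mon_def map_free_mult map_free_power mult.assoc)
    then show ?thesis
      using rep_sl2_independent[of G t "sl2_mon m" \<phi> 0 0] by (simp add: rep_mult rep_T_power)
  qed
  have rep_p: "rep G t p \<phi> = (\<lambda>a b. \<Sum>m\<in>A. c m * (t ^ T_exp m * rep 0 0 (map_free Inl (sl2_mon m)) \<phi> a b))"
    for t \<phi>
  proof -
    have "rep G t p \<phi> = rep G t (\<Sum>m\<in>A. scalar (c m) * monomial m) \<phi>"
      using rep_ideal[OF diff, of t \<phi>] by (simp add: rep_diff fun_eq_iff)
    then show ?thesis
      by (simp add: rep_sum rep_mult mon)
  qed
  have rep_comm: "rep G t p (act_gen G t g \<phi>) = act_gen G t g (rep G t p \<phi>)" for t g \<phi>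
    using rep_ideal[OF comm[of "gen g"], of t \<phi>] by (simp add: rep_diff rep_mult fun_eq_iff)
  define v where "v t a b = rep G t p (delta a b) a b" for t a b
  have diag: "rep G t p (delta a b) = (\<lambda>a' b'. v t a b * delta a b a' b')" for t a b
  proof (intro ext)
    fix a' b'
    consider "a' - b' \<noteq> a - b" | "a' + b' \<noteq> a + b" | "a' = a" "b' = b" by linarith
    then show "rep G t p (delta a b) a' b' = v t a b * delta a b a' b'"
    proof cases
      case 1
      then have "delta a b a' b' = 0"
        by (auto simp: delta_def)
      with 1 show ?thesis
        by (simp add: rep_p rep_sl2_support)
    next
      case 2
      have "act_gen G t (Inl Sl2_h) (delta a b) = (\<lambda>a' b'. of_int (a + b) * delta a b a' b')"
        by (auto simp: delta_def fun_eq_iff)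
      then have "of_int (a + b) * rep G t p (delta a b) a' b' = of_int (a' + b') * rep G t p (delta a b) a' b'"
        using rep_comm[of t "Inl Sl2_h" "delta a b"] by (simp only: rep_fun_scale act_gen.simps fun_eq_iff)
      with 2 have "rep G t p (delta a b) a' b' = 0"
        by (simp only: mult_cancel_right of_int_eq_iff) auto
      with 2 show ?thesis by (auto simp: delta_def)
    next
      case 3
      then show ?thesis by (simp add: v_def delta_def)
    qed
  qed
  have e_inv: "v t (a + 1) (b + 1) = v t a b" for t a b
  proof -
    have "act_gen G t (Inl Sl2_e) (delta a b) = delta (a + 1) (b + 1)"
      by (auto simp: delta_def fun_eq_iff)
    then have "rep G t p (delta (a + 1) (b + 1)) = act_gen G t (Inl Sl2_e) (rep G t p (delta a b))"
      using rep_comm[of t "Inl Sl2_e" "delta a b"] by (simp only:)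
    from fun_cong[OF fun_cong[OF this], of "a + 1" "b + 1"] show ?thesis
      by (simp add: v_def)
  qed
  have x_inv: "v t (a + 1) b = v t a b" for t a b
  proof -
    \<comment> \<open>The entry at (a+1, b) compares the two eigenvalues, since the raising
      coefficient never vanishes.\<close>
    have "act_gen G t (Inr V_x) (delta a b)
      = (\<lambda>a' b'. raise_coeff (a - b) * delta (a + 1) b a' b' + lower_coeff G t (a - b) * delta a (b + 1) a' b')"
      by (auto simp: delta_def fun_eq_iff)
    then have "rep G t p (act_gen G t (Inr V_x) (delta a b)) (a + 1) b = raise_coeff (a - b) * v t (a + 1) b"
      by (simp only: rep_fun_add rep_fun_scale diag) (simp add: delta_def)
    moreover have "act_gen G t (Inr V_x) (rep G t p (delta a b)) (a + 1) b = raise_coeff (a - b) * v t a b"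
      by (simp only: act_gen.simps diag) (simp add: delta_def)
    ultimately show ?thesis
      using rep_comm[of t "Inr V_x" "delta a b"] raise_coeff_nonzero by simp
  qed
  have y_inv: "v t a (b + 1) = v t a b" for t a b
    using e_inv[of t a b] x_inv[of t a "b + 1"] by simp
  have const: "v t a b = v t 0 0" for t a b
    using int_shift_invariant[of "\<lambda>a. v t a b" a, OF x_inv]
      int_shift_invariant[of "\<lambda>b. v t 0 b" b, OF y_inv] by simp
  \<comment> \<open>The eigenvalue as a polynomial in t: the U(sl2) factors act independently of t,
    so only the powers of T contribute it.\<close>
  define g where "g = (\<Sum>m\<in>A. Polynomial.monom
    (c m * rep 0 0 (map_free Inl (sl2_mon m)) (delta 0 0) 0 0) (T_exp m))"
  have g: "poly g t = v t 0 0" for t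
    by (simp add: g_def v_def rep_p poly_sum poly_monom mult_ac)
  show thesis
  proof (rule that[of g], rule rep_delta_faithful)
    fix t a b
    show "rep G t (p - alg_eval g T) (delta a b) = (\<lambda>_ _. 0)"
      by (simp add: rep_diff diag rep_alg_eval_T g const[of t a b])
  qed
qed

section \<open>The center as a ring of polynomials in the class of T\<close>

lemma hecke_class_eq_iff: "hecke_class z p = hecke_class z q \<longleftrightarrow> p - q \<in> I"
  unfolding hecke_class_def by (rule coset_eq_iff)

lemma hecke_class_mult: "hecke_class z p \<otimes>\<^bsub>hecke z\<^esub> hecke_class z q = hecke_class z (p * q)"
  unfolding hecke_class_def hecke_def by (rule coset_mult)

lemma hecke_class_add: "hecke_class z p \<oplus>\<^bsub>hecke z\<^esub> hecke_class z q = hecke_class z (p + q)"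
  unfolding hecke_class_def hecke_def by (rule coset_add)

lemma hecke_one: "\<one>\<^bsub>hecke z\<^esub> = hecke_class z 1"
  by (simp add: hecke_def hecke_class_def FactRing_def)

lemma hecke_zero: "\<zero>\<^bsub>hecke z\<^esub> = hecke_class z 0"
  by (auto simp: hecke_def hecke_class_def FactRing_def coset_free_ring)

lemma hecke_center_mem_iff: "hecke_class z p \<in> carrier (hecke_center z) \<longleftrightarrow> (\<forall>q. p * q - q * p \<in> I)"
  by (simp add: hecke_center_def hecke_def hecke_class_def coset_in_ring_center_iff)

lemma hecke_center_carrier: "carrier (hecke_center z) = range (\<lambda>g. hecke_class z (alg_eval g T))"
proof -
  have "carrier (hecke_center z) \<subseteq> range (hecke_class z)"
    by (auto simp: hecke_center_def ring_center_def hecke_def carrier_free_Quot hecke_class_def[abs_def])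
  then have "carrier (hecke_center z) = {hecke_class z p | p. \<forall>q. p * q - q * p \<in> I}"
    using hecke_center_mem_iff by blast
  also have "\<dots> = range (\<lambda>g. hecke_class z (alg_eval g T))"
  proof (intro equalityI subsetI)
    fix C assume "C \<in> {hecke_class z p | p. \<forall>q. p * q - q * p \<in> I}"
    then obtain p where p: "C = hecke_class z p" "\<And>q. p * q - q * p \<in> I" by blast
    obtain g where "p - alg_eval g T \<in> I"
      using central_imp_alg_eval_T[OF p(2)] by blast
    then have "C = hecke_class z (alg_eval g T)"
      by (simp add: p(1) hecke_class_eq_iff)
    then show "C \<in> range (\<lambda>g. hecke_class z (alg_eval g T))" by blast
  qed (use alg_eval_T_central in blast)
  finally show ?thesis .
qed

lemma hecke_class_alg_eval_eq_iff:
  "hecke_class z (alg_eval g T) = hecke_class z (alg_eval g' T) \<longleftrightarrow> g = g'"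
proof
  assume "hecke_class z (alg_eval g T) = hecke_class z (alg_eval g' T)"
  then have "alg_eval g T - alg_eval g' T \<in> I"
    by (simp add: hecke_class_eq_iff)
  from rep_ideal[OF this, of _ "\<lambda>_ _. 1"] have "poly g t = poly g' t" for t
    by (simp add: rep_diff rep_alg_eval_T fun_eq_iff)
  then show "g = g'"
    by (simp add: poly_eq_poly_eq_iff[symmetric] fun_eq_iff)
qed simp

lemma hecke_center_ops:
  "(\<otimes>\<^bsub>hecke_center z\<^esub>) = (\<otimes>\<^bsub>hecke z\<^esub>)" "(\<oplus>\<^bsub>hecke_center z\<^esub>) = (\<oplus>\<^bsub>hecke z\<^esub>)"
  "\<one>\<^bsub>hecke_center z\<^esub> = \<one>\<^bsub>hecke z\<^esub>" "\<zero>\<^bsub>hecke_center z\<^esub> = \<zero>\<^bsub>hecke z\<^esub>"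
  by (simp_all add: hecke_center_def)

lemma hecke_center_add: "hecke_class z (alg_eval g T) \<oplus>\<^bsub>hecke_center z\<^esub> hecke_class z (alg_eval g' T)
    = hecke_class z (alg_eval (g + g') T)"
  unfolding hecke_center_ops hecke_class_add hecke_class_eq_iff
  by (rule congruent_if_rep_scalar[where u = "poly (g + g')"])
     (simp_all add: rep_add rep_alg_eval_T distrib_right)

lemma hecke_center_mult: "hecke_class z (alg_eval g T) \<otimes>\<^bsub>hecke_center z\<^esub> hecke_class z (alg_eval g' T)
    = hecke_class z (alg_eval (g * g') T)"
  unfolding hecke_center_ops hecke_class_mult hecke_class_eq_iff
  by (rule congruent_if_rep_scalar[where u = "poly (g * g')"])
     (simp_all add: rep_mult rep_alg_eval_T mult.assoc)

lemma hecke_center_scalar: "hecke_scalar z c = hecke_class z (alg_eval [:c:] T)"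
  unfolding hecke_scalar_def hecke_class_eq_iff
  by (rule congruent_if_rep_scalar[where u = "\<lambda>_. c"]) (simp_all add: rep_alg_eval_T)

lemma hecke_center_one: "\<one>\<^bsub>hecke_center z\<^esub> = hecke_class z (alg_eval 1 T)"
  unfolding hecke_center_ops hecke_one hecke_class_eq_iff
  by (rule congruent_if_rep_scalar[where u = "\<lambda>_. 1"]) (simp_all add: rep_alg_eval_T)

lemma hecke_center_zero: "\<zero>\<^bsub>hecke_center z\<^esub> = hecke_class z (alg_eval 0 T)"
  unfolding hecke_center_ops hecke_zero by (simp add: alg_eval_def)

lemma cring_hecke_center: "cring (hecke_center z)"
proof (rule cringI)
  show "abelian_group (hecke_center z)"
  proof (rule abelian_groupI)
    fix a assume "a \<in> carrier (hecke_center z)"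
    then obtain g where "a = hecke_class z (alg_eval g T)"
      by (auto simp: hecke_center_carrier)
    then show "\<exists>b\<in>carrier (hecke_center z). b \<oplus>\<^bsub>hecke_center z\<^esub> a = \<zero>\<^bsub>hecke_center z\<^esub>"
      by (intro bexI[of _ "hecke_class z (alg_eval (- g) T)"])
         (auto simp: hecke_center_carrier hecke_center_add hecke_center_zero)
  qed (auto simp: hecke_center_carrier hecke_center_add hecke_center_zero add_ac)
  show "comm_monoid (hecke_center z)"
    by (rule comm_monoidI)
       (auto simp: hecke_center_carrier hecke_center_mult hecke_center_one mult_ac)
qed (auto simp: hecke_center_carrier hecke_center_mult hecke_center_add distrib_right)

lemma hecke_class_T: "hecke_class z T = hecke_class z (alg_eval [:0, 1:] T)"
  unfolding hecke_class_eq_iff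
  by (rule congruent_if_rep_scalar[where u = "\<lambda>t. t"]) (simp_all add: rep_alg_eval_T rep_T)

lemma hecke_center_power:
  "hecke_class z (alg_eval g T) [^]\<^bsub>hecke_center z\<^esub> (n :: nat) = hecke_class z (alg_eval (g ^ n) T)"
proof (induction n)
  case 0
  show ?case by (simp add: hecke_center_one)
next
  case (Suc n)
  then show ?case by (simp add: hecke_center_mult mult.commute)
qed

lemma eval_hecke_center:
  assumes "p \<in> carrier (UP (ring_of_type_algebra :: complex ring))"
  shows "eval ring_of_type_algebra (hecke_center z) (hecke_scalar z) (hecke_class z T) p
    = hecke_class z (alg_eval (poly_of_UP p) T)"
proof -
  interpret C: cring "hecke_center z" by (rule cring_hecke_center)
  have summand: "hecke_scalar z c \<otimes>\<^bsub>hecke_center z\<^esub> hecke_class z T [^]\<^bsub>hecke_center z\<^esub> i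
    = hecke_class z (alg_eval (Polynomial.monom c i) T)" for c and i :: nat
    by (simp add: hecke_center_scalar hecke_class_T hecke_center_power hecke_center_mult
        monom_altdef)
  have "(\<Oplus>\<^bsub>hecke_center z\<^esub>i\<in>{..n}. hecke_class z (alg_eval (u i) T))
    = hecke_class z (alg_eval (\<Sum>i\<le>n. u i) T)" for u and n :: nat
  proof (induction n)
    case 0
    show ?case
      by (simp add: hecke_center_carrier)
  next
    case (Suc n)
    then show ?case
      by (simp add: hecke_center_carrier hecke_center_add Pi_def add.commute)
  qed
  then show ?thesis
    using assms by (simp add: eval_def coeff_UP[OF assms] summand poly_of_UP_def)
qed

lemma polynomial_algebra_center: "polynomial_algebra_on (hecke_center z) (hecke_scalar z) (hecke_class z T)"
  unfolding polynomial_algebra_on_def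
proof
  let ?R = "ring_of_type_algebra :: complex ring"
  let ?ev = "eval ?R (hecke_center z) (hecke_scalar z) (hecke_class z T)"
  interpret R: cring ?R by (rule cring_from_type_algebra)
  interpret C: cring "hecke_center z" by (rule cring_hecke_center)
  show T: "hecke_class z T \<in> carrier (hecke_center z)"
    by (auto simp: hecke_center_carrier hecke_class_T)
  have "hecke_scalar z \<in> ring_hom ?R (hecke_center z)"
    by (rule ring_hom_memI)
       (auto simp: hecke_center_scalar hecke_center_carrier hecke_center_mult hecke_center_add
          hecke_center_one one_pCons mult.commute)
  then interpret UP_pre_univ_prop ?R "hecke_center z" "hecke_scalar z" "UP ?R"
    by unfold_locales auto
  have "?ev \<in> ring_hom (UP ?R) (hecke_center z)"
    using eval_ring_hom[OF T] .
  moreover have "bij_betw ?ev (carrier (UP ?R)) (carrier (hecke_center z))"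
  proof (rule bij_betwI')
    fix p q assume pq: "p \<in> carrier (UP ?R)" "q \<in> carrier (UP ?R)"
    show "?ev p = ?ev q \<longleftrightarrow> p = q"
    proof
      assume "?ev p = ?ev q"
      then have "poly_of_UP p = poly_of_UP q"
        using pq by (simp add: eval_hecke_center hecke_class_alg_eval_eq_iff)
      then have "poly.coeff (poly_of_UP p) = poly.coeff (poly_of_UP q)"
        by simp
      then show "p = q"
        using coeff_poly_of_UP[OF pq(1)] coeff_poly_of_UP[OF pq(2)] by (simp add: fun_eq_iff)
    qed simp
  next
    fix p assume "p \<in> carrier (UP ?R)"
    then show "?ev p \<in> carrier (hecke_center z)"
      by (simp add: eval_hecke_center hecke_center_carrier)
  next
    fix C assume "C \<in> carrier (hecke_center z)"
    then obtain g where g: "C = hecke_class z (alg_eval g T)"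
      by (auto simp: hecke_center_carrier)
    have "poly.coeff g \<in> carrier (UP ?R)"
      by (auto simp: UP_def up_def bound_def intro!: exI[of _ "Polynomial.degree g"] coeff_eq_0)
    moreover from coeff_poly_of_UP[OF this] have "poly_of_UP (poly.coeff g) = g"
      by (intro poly_eqI)
    ultimately show "\<exists>p\<in>carrier (UP ?R). C = ?ev p"
      using g by (intro bexI[of _ "poly.coeff g"]) (simp_all add: eval_hecke_center)
  qed
  ultimately show "?ev \<in> ring_iso (UP ?R) (hecke_center z)"
    by (simp add: ring_iso_def)
qed

text \<open>The upper bound is visible in the words of T. For the lower bound, a representative of
  degree below 2 has a normal form without the monomial T, and subtracting T from it would give a
  nontrivial relation between basis monomials.\<close>

lemma filtration_degree_T: "filtration_degree z (hecke_class z T) = 2"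
  unfolding filtration_degree_def
proof (rule Least_equality)
  have "V_length w \<le> 2" if "w \<in> Poly_Mapping.keys T" for w
  proof -
    have "Poly_Mapping.keys T \<subseteq> Poly_Mapping.keys (f * x * x) \<union> Poly_Mapping.keys (e * y * y)
      \<union> Poly_Mapping.keys (h * x * y) \<union> Poly_Mapping.keys (map_free Inl sl2_part)"
    proof
      fix w assume "w \<in> Poly_Mapping.keys T"
      then show "w \<in> Poly_Mapping.keys (f * x * x) \<union> Poly_Mapping.keys (e * y * y)
        \<union> Poly_Mapping.keys (h * x * y) \<union> Poly_Mapping.keys (map_free Inl sl2_part)"
        by (auto simp: in_keys_iff T_def lookup_add lookup_minus)
    qed
    then have "w \<in> {[Inl Sl2_f, Inr V_x, Inr V_x], [Inl Sl2_e, Inr V_y, Inr V_y],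
        [Inl Sl2_h, Inr V_x, Inr V_y]} \<or> w \<in> range (map Inl)"
      using that keys_map_free[of Inl sl2_part] by (auto simp: gen_def mult_single_list)
    moreover have "V_length (map Inl u) = 0" for u
      by (auto simp: V_length_def filter_empty_conv)
    ultimately show ?thesis
      by (auto simp: V_length_def)
  qed
  then show "hecke_class z T \<in> hecke_filtration z 2"
    by (auto simp: hecke_filtration_def)
next
  fix n assume "hecke_class z T \<in> hecke_filtration z n"
  then obtain p where p: "hecke_class z T = hecke_class z p" "\<forall>w\<in>Poly_Mapping.keys p. V_length w \<le> n"
    by (auto simp: hecke_filtration_def)
  from p(2) obtain A c where A: "finite A" "A \<subseteq> normal_exponents" "\<forall>m\<in>A. exponents_degree m \<le> n"
    "\<forall>m\<in>A. c m \<noteq> 0" and diff: "p - (\<Sum>m\<in>A. scalar (c m) * monomial m) \<in> I"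
    by (rule normal_form[of p n])
  show "2 \<le> n"
  proof (rule ccontr)
    assume "\<not> 2 \<le> n"
    \<comment> \<open>The exponents of the monomial T itself; it gets the coefficient -1 in the
      relation.\<close>
    let ?m = "(1, 0, 0, 0, 0, 0) :: exponents"
    have notin: "?m \<notin> A"
      using A(3) \<open>\<not> 2 \<le> n\<close> by auto
    have "(\<Sum>m\<in>A. scalar (c m) * monomial m) = (\<Sum>m\<in>A. scalar ((c(?m := - 1)) m) * monomial m)"
      using notin by (intro sum.cong) auto
    then have "(\<Sum>m\<in>insert ?m A. scalar ((c(?m := - 1)) m) * monomial m)
      = - (T - p) - (p - (\<Sum>m\<in>A. scalar (c m) * monomial m))"
      using A(1) notin by (simp add: scalar_uminus)
    also have "\<dots> \<in> I"
      using p(1) by (intro diff_mem[OF uminus_mem diff]) (simp add: hecke_class_eq_iff)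
    finally have mem: "(\<Sum>m\<in>insert ?m A. scalar ((c(?m := - 1)) m) * monomial m) \<in> I" .
    have "insert ?m A = {}"
      by (rule monomials_independent_rep[where c = "c(?m := - 1)"])
         (use A rep_ideal[OF mem] in \<open>auto simp: normal_exponents_def\<close>)
    then show False by simp
  qed
qed

end

theorem theorem0p1:
  fixes z :: "sl2_basis free_alg set"
  assumes "z \<in> ring_center U_sl2"
  shows "\<exists>t. polynomial_algebra_on (hecke_center z) (hecke_scalar z) t
             \<and> filtration_degree z t = 2"
proof -
  obtain P where P: "\<And>w G t \<phi>. w \<in> z \<Longrightarrow>
    rep G t (map_free Inl w) \<phi> = (\<lambda>a b. poly P ((of_int (a - b) + 1/2)\<^sup>2) * \<phi> a b)"
    using rep_U_sl2_center[OF assms] by blast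
  obtain G where G: "\<forall>l :: complex. poly G ((l + 1/2)\<^sup>2) - poly G ((l - 1/2)\<^sup>2) = l * poly P (l\<^sup>2)"
    using ex_central_antidifference[of P] by (elim exE)
  obtain A B where AB: "\<forall>l. poly G ((l - 1/2)\<^sup>2) = poly A (l\<^sup>2) - l * poly B (l\<^sup>2)
             \<and> poly G ((l + 1/2)\<^sup>2) = poly A (l\<^sup>2) + l * poly B (l\<^sup>2)"
    using poly_half_shift_decomp[of G] by (elim exE)
  obtain p where "z = genideal free_ring sl2_relations +>\<^bsub>free_ring\<^esub> p"
    using assms unfolding ring_center_def U_sl2_def by (auto simp: carrier_free_Quot)
  then have "p \<in> z"
    using free_ideal.zero_mem[OF free_ideal_genideal] by (auto simp: coset_free_ring intro: exI[of _ 0])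
  \<comment> \<open>The odd parts cancel in the sum of the two half shifts of G, which leaves Q =
    2A.\<close>
  then interpret hecke_setup z p P G "Polynomial.smult 2 A"
    using assms P G AB by unfold_locales simp_all
  show ?thesis
    using polynomial_algebra_center filtration_degree_T by blast
qed

end
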